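(* Let $(K,<)$ be an ordered field and let $v$ be a convex valuation on $K$. Suppose that at least one of the following holds: (i) $vK$ is $p$-regular but not $p$-divisible for some prime $p\in\mathbb{N}$. (ii) $Kv$ is dense in its real closure but not real closed. Then $v$ is $\emptyset$-$\mathcal{L}_{\mathrm{or}}$-definable in $(K,<)$.
   Context: $\mathcal{L}_{\mathrm{or}}=\{+,-,\cdot,0,1,<\}$ is the language of ordered rings. A valuation $v$ is $\emptyset$-$\mathcal{L}_{\mathrm{or}}$-definable if its valuation ring $\mathcal{O}_v\subseteq K$ is defined by an $\mathcal{L}_{\mathrm{or}}$-formula without parameters. For a valuation $v$ on $K$, $vK$ denotes the value group (an ordered abelian group) and $Kv$ the residue field. The valuation $v$ is convex (with respect to $<$) if $\mathcal{O}_v$ is a convex subset of $(K,<)$; then $<$ induces an ordering on $Kv$, and the real closure of $Kv$ is taken with respect to this ordering. An ordered abelian group $G$ is $p$-regular if $G/C$ is $p$-divisible for every non-trivial convex subgroup $C\leq G$. "Dense" refers to the order topology on the real closure. *)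

theory Defs
  imports
    "HOL-Analysis.Elementary_Topology"
    "HOL-Library.Extended"
    "HOL-Algebra.Finite_Extensions"
    "HOL-Algebra.Algebraic_Closure_Type"
begin
datatype or_term =
    Var nat
  | Zero
  | One
  | Plus or_term or_term
  | Minus or_term or_term
  | Times or_term or_term

datatype or_formula =
    Eq or_term or_term
  | Less or_term or_term
  | Not or_formula
  | And or_formula or_formula
  | Ex nat or_formula

fun tm_val :: "(nat \<Rightarrow> 'a::linordered_field) \<Rightarrow> or_term \<Rightarrow> 'a" where
  "tm_val E (Var n) = E n"
| "tm_val E Zero = 0"
| "tm_val E One = 1"
| "tm_val E (Plus s t) = tm_val E s + tm_val E t"
| "tm_val E (Minus s t) = tm_val E s - tm_val E t"
| "tm_val E (Times s t) = tm_val E s * tm_val E t"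

fun sat :: "(nat \<Rightarrow> 'a::linordered_field) \<Rightarrow> or_formula \<Rightarrow> bool" where
  "sat E (Eq s t) \<longleftrightarrow> tm_val E s = tm_val E t"
| "sat E (Less s t) \<longleftrightarrow> tm_val E s < tm_val E t"
| "sat E (Not \<phi>) \<longleftrightarrow> \<not> sat E \<phi>"
| "sat E (And \<phi> \<psi>) \<longleftrightarrow> sat E \<phi> \<and> sat E \<psi>"
| "sat E (Ex n \<phi>) \<longleftrightarrow> (\<exists>a. sat (E(n := a)) \<phi>)"

fun tm_vars :: "or_term \<Rightarrow> nat set" where
  "tm_vars (Var n) = {n}"
| "tm_vars Zero = {}"
| "tm_vars One = {}"
| "tm_vars (Plus s t) = tm_vars s \<union> tm_vars t"
| "tm_vars (Minus s t) = tm_vars s \<union> tm_vars t"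
| "tm_vars (Times s t) = tm_vars s \<union> tm_vars t"

fun free_vars :: "or_formula \<Rightarrow> nat set" where
  "free_vars (Eq s t) = tm_vars s \<union> tm_vars t"
| "free_vars (Less s t) = tm_vars s \<union> tm_vars t"
| "free_vars (Not \<phi>) = free_vars \<phi>"
| "free_vars (And \<phi> \<psi>) = free_vars \<phi> \<union> free_vars \<psi>"
| "free_vars (Ex n \<phi>) = free_vars \<phi> - {n}"

definition definable_without_parameters :: "'a::linordered_field set \<Rightarrow> bool" where
  "definable_without_parameters A \<longleftrightarrow>
     (\<exists>\<phi>. free_vars \<phi> \<subseteq> {0} \<and> (\<forall>E. sat E \<phi> \<longleftrightarrow> E 0 \<in> A))"

definition p_divisible :: "nat \<Rightarrow> ('g, 'm) monoid_scheme \<Rightarrow> bool" where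
  "p_divisible p G \<longleftrightarrow> (\<forall>x\<in>carrier G. \<exists>y\<in>carrier G. y [^]\<^bsub>G\<^esub> p = x)"

definition convex_subgroup :: "'g::linorder set \<Rightarrow> ('g, 'm) monoid_scheme \<Rightarrow> bool" where
  "convex_subgroup C G \<longleftrightarrow> subgroup C G \<and>
     (\<forall>x\<in>C. \<forall>y\<in>C. \<forall>z\<in>carrier G. x \<le> z \<and> z \<le> y \<longrightarrow> z \<in> C)"

definition p_regular :: "nat \<Rightarrow> ('g::linorder, 'm) monoid_scheme \<Rightarrow> bool" where
  "p_regular p G \<longleftrightarrow>
     (\<forall>C. convex_subgroup C G \<and> C \<noteq> {\<one>\<^bsub>G\<^esub>} \<longrightarrow> p_divisible p (G Mod C))"

locale ordered_field = field F for F :: "('f, 'm) ring_scheme" (structure) +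
  fixes leq :: "'f \<Rightarrow> 'f \<Rightarrow> bool"
  assumes le_refl: "x \<in> carrier F \<Longrightarrow> leq x x"
    and le_antisym: "\<lbrakk>x \<in> carrier F; y \<in> carrier F; leq x y; leq y x\<rbrakk> \<Longrightarrow> x = y"
    and le_trans: "\<lbrakk>x \<in> carrier F; y \<in> carrier F; z \<in> carrier F; leq x y; leq y z\<rbrakk> \<Longrightarrow> leq x z"
    and le_total: "\<lbrakk>x \<in> carrier F; y \<in> carrier F\<rbrakk> \<Longrightarrow> leq x y \<or> leq y x"
    and le_add: "\<lbrakk>x \<in> carrier F; y \<in> carrier F; z \<in> carrier F; leq x y\<rbrakk> \<Longrightarrow> leq (x \<oplus> z) (y \<oplus> z)"
    and le_mult: "\<lbrakk>x \<in> carrier F; y \<in> carrier F; leq \<zero> x; leq \<zero> y\<rbrakk> \<Longrightarrow> leq \<zero> (x \<otimes> y)"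

text \<open>The axioms of real closed ordered fields: nonnegative elements are squares and polynomials
  of odd degree have roots.  As the ordering of a real closed field is determined by its field
  structure, the choice of the ordering \<open>leq\<close> is immaterial.\<close>

definition real_closed :: "('f, 'm) ring_scheme \<Rightarrow> ('f \<Rightarrow> 'f \<Rightarrow> bool) \<Rightarrow> bool" where
  "real_closed F leq \<longleftrightarrow> ordered_field F leq \<and>
     (\<forall>x\<in>carrier F. leq \<zero>\<^bsub>F\<^esub> x \<longrightarrow> (\<exists>y\<in>carrier F. y \<otimes>\<^bsub>F\<^esub> y = x)) \<and>
     (\<forall>p\<in>carrier (univ_poly F (carrier F)). odd (Polynomials.degree p) \<longrightarrow>
        (\<exists>x\<in>carrier F. ring.eval F p x = \<zero>\<^bsub>F\<^esub>))"

text \<open>A real closure of an ordered field is a real closed algebraic extension whose ordering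
  extends the given one; it is unique up to a unique isomorphism over the base field.
  Here it is carried by an arbitrary type of sort \<open>linordered_field\<close>, with the base field
  embedded by \<open>\<iota>\<close>.\<close>

definition real_closure ::
    "('f, 'm) ring_scheme \<Rightarrow> ('f \<Rightarrow> 'f \<Rightarrow> bool) \<Rightarrow> ('f \<Rightarrow> 'r::linordered_field) \<Rightarrow> bool" where
  "real_closure F leq \<iota> \<longleftrightarrow>
     \<iota> \<in> ring_hom F ring_of_type_algebra \<and>
     (\<forall>x\<in>carrier F. \<forall>y\<in>carrier F. leq x y \<longleftrightarrow> \<iota> x \<le> \<iota> y) \<and>
     real_closed (ring_of_type_algebra :: 'r ring) (\<le>) \<and>
     (\<forall>r. ring.algebraic ring_of_type_algebra (\<iota> ` carrier F) r)"

definition valuation :: "('a::field \<Rightarrow> 'g::linordered_ab_group_add extended) \<Rightarrow> bool" where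
  "valuation v \<longleftrightarrow>
     (\<forall>x. v x \<noteq> Minf) \<and>
     (\<forall>x. v x = Pinf \<longleftrightarrow> x = 0) \<and>
     (\<forall>x y. v (x * y) = v x + v y) \<and>
     (\<forall>x y. min (v x) (v y) \<le> v (x + y))"

definition valuation_ring :: "('a::field \<Rightarrow> 'g::linordered_ab_group_add extended) \<Rightarrow> 'a set" where
  "valuation_ring v = {x. 0 \<le> v x}"

definition valuation_ideal :: "('a::field \<Rightarrow> 'g::linordered_ab_group_add extended) \<Rightarrow> 'a set" where
  "valuation_ideal v = {x. 0 < v x}"

definition convex_valuation ::
    "('a::linordered_field \<Rightarrow> 'g::linordered_ab_group_add extended) \<Rightarrow> bool" where
  "convex_valuation v \<longleftrightarrow> valuation v \<and>
     (\<forall>x\<in>valuation_ring v. \<forall>y\<in>valuation_ring v. \<forall>z. x \<le> z \<and> z \<le> y \<longrightarrow> z \<in> valuation_ring v)"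

text \<open>The type of values may be larger than the value group, since valuations are not
  required to be surjective.\<close>

definition value_group ::
    "('a::field \<Rightarrow> 'g::linordered_ab_group_add extended) \<Rightarrow> 'g monoid" where
  "value_group v = \<lparr>carrier = {g. \<exists>x. v x = Fin g}, monoid.mult = (+), one = 0\<rparr>"

definition residue_field ::
    "('a::field \<Rightarrow> 'g::linordered_ab_group_add extended) \<Rightarrow> 'a set ring" where
  "residue_field v = ring_of_type_algebra\<lparr>carrier := valuation_ring v\<rparr> Quot valuation_ideal v"

text \<open>The ordering induced on the residue field, whose elements are cosets of the
  valuation ideal.\<close>

definition residue_le :: "'a::linordered_field set \<Rightarrow> 'a set \<Rightarrow> bool" where
  "residue_le A B \<longleftrightarrow> (\<exists>x\<in>A. \<exists>y\<in>B. x \<le> y)"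

end

theory Submission
  imports Defs
begin

text \<open>
  Let \<open>O\<close> be the valuation ring.

  (i) For \<open>\<epsilon> > 0\<close> consider the \<open>z \<ge> 1\<close> for which no \<open>p\<close>-th power lies between \<open>\<epsilon> / z\<^sup>p\<^sup>+\<^sup>1\<close> and
  \<open>\<epsilon>\<close>. As the value group is \<open>p\<close>-regular, every interval of length \<open>p \<gamma>\<close> in it meets the multiples
  of \<open>p\<close>, so that all these \<open>z\<close> are in \<open>O\<close>, whatever \<open>\<epsilon>\<close> is. If \<open>v \<epsilon>\<close> is not divisible by \<open>p\<close>, then
  conversely all \<open>z \<ge> 1\<close> in \<open>O\<close> are of this kind. Hence \<open>O\<close> is defined by quantifying over \<open>\<epsilon>\<close>.

  (ii) As the residue field \<open>k\<close> is not real closed, there is a polynomial over \<open>k\<close> that changes its sign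
  between two points of \<open>k\<close>, but has no root in \<open>k\<close>. Let \<open>F\<close>, \<open>a\<close>, \<open>b\<close> be lifts of the polynomial and of
  the two points. By the intermediate value theorem in the real closure, in which \<open>k\<close> is dense, the
  values of \<open>F\<close> on \<open>[a, b]\<close> come arbitrarily close to the valuation ideal, but do not enter it; so
  \<open>O\<close> consists of the \<open>x\<close> with \<open>\<bar>x * F y\<bar> \<le> 1\<close> for some \<open>y\<close> in \<open>[a, b]\<close>. For arbitrary parameters
  with \<open>F a \<le> 0 \<le> F b\<close> that belong to the set that they define in this way, this set still contains
  \<open>O\<close>. Hence \<open>O\<close> is the intersection of all these sets, where only the degree of \<open>F\<close> is fixed.
\<close>

section \<open>Definable predicates\<close>

text \<open>Terms and formulas are represented by the functions of the environment that they
  compute. The closure properties below then act as introduction rules, so that no formula has to be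
  written out.\<close>

definition definable_term :: "nat set \<Rightarrow> ((nat \<Rightarrow> 'a::linordered_field) \<Rightarrow> 'a) \<Rightarrow> bool" where
  "definable_term V t \<longleftrightarrow> (\<exists>s. tm_vars s \<subseteq> V \<and> (\<forall>E. tm_val E s = t E))"

definition definable_pred :: "nat set \<Rightarrow> ((nat \<Rightarrow> 'a::linordered_field) \<Rightarrow> bool) \<Rightarrow> bool" where
  "definable_pred V P \<longleftrightarrow> (\<exists>\<phi>. free_vars \<phi> \<subseteq> V \<and> (\<forall>E. sat E \<phi> \<longleftrightarrow> P E))"

lemma definable_term_var: "n \<in> V \<Longrightarrow> definable_term V (\<lambda>E. E n)"
  unfolding definable_term_def by (rule exI[of _ "Var n"]) auto

lemma definable_term_zero: "definable_term V (\<lambda>E. 0)"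
  unfolding definable_term_def by (rule exI[of _ "Zero"]) auto

lemma definable_term_one: "definable_term V (\<lambda>E. 1)"
  unfolding definable_term_def by (rule exI[of _ "One"]) auto

lemma definable_term_add:
  assumes "definable_term V s" "definable_term V t"
  shows "definable_term V (\<lambda>E. s E + t E)"
proof -
  obtain s' t' where "tm_vars s' \<subseteq> V" "\<forall>E. tm_val E s' = s E" "tm_vars t' \<subseteq> V" "\<forall>E. tm_val E t' = t E"
    using assms by (auto simp: definable_term_def)
  then show ?thesis
    unfolding definable_term_def by (intro exI[of _ "Plus s' t'"]) auto
qed

lemma definable_term_diff:
  assumes "definable_term V s" "definable_term V t"
  shows "definable_term V (\<lambda>E. s E - t E)"
proof -
  obtain s' t' where "tm_vars s' \<subseteq> V" "\<forall>E. tm_val E s' = s E" "tm_vars t' \<subseteq> V" "\<forall>E. tm_val E t' = t E"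
    using assms by (auto simp: definable_term_def)
  then show ?thesis
    unfolding definable_term_def by (intro exI[of _ "Minus s' t'"]) auto
qed

lemma definable_term_mult:
  assumes "definable_term V s" "definable_term V t"
  shows "definable_term V (\<lambda>E. s E * t E)"
proof -
  obtain s' t' where "tm_vars s' \<subseteq> V" "\<forall>E. tm_val E s' = s E" "tm_vars t' \<subseteq> V" "\<forall>E. tm_val E t' = t E"
    using assms by (auto simp: definable_term_def)
  then show ?thesis
    unfolding definable_term_def by (intro exI[of _ "Times s' t'"]) auto
qed

lemma definable_term_uminus: "definable_term V t \<Longrightarrow> definable_term V (\<lambda>E. - t E)"
  using definable_term_diff[OF definable_term_zero] by force

lemma definable_term_power: "definable_term V t \<Longrightarrow> definable_term V (\<lambda>E. t E ^ n)"
  by (induction n) (auto intro: definable_term_one definable_term_mult)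

lemma definable_term_sum:
  fixes n :: nat
  assumes "\<And>i. i \<le> n \<Longrightarrow> definable_term V (t i)"
  shows "definable_term V (\<lambda>E. \<Sum>i\<le>n. t i E)"
  using assms by (induction n) (auto intro: definable_term_add)

lemma definable_pred_less:
  assumes "definable_term V s" "definable_term V t"
  shows "definable_pred V (\<lambda>E. s E < t E)"
proof -
  obtain s' t' where "tm_vars s' \<subseteq> V" "\<forall>E. tm_val E s' = s E" "tm_vars t' \<subseteq> V" "\<forall>E. tm_val E t' = t E"
    using assms by (auto simp: definable_term_def)
  then show ?thesis
    unfolding definable_pred_def by (intro exI[of _ "Less s' t'"]) auto
qed

lemma definable_pred_not:
  assumes "definable_pred V P"
  shows "definable_pred V (\<lambda>E. \<not> P E)"
proof -
  obtain \<phi> where "free_vars \<phi> \<subseteq> V" "\<forall>E. sat E \<phi> \<longleftrightarrow> P E"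
    using assms by (auto simp: definable_pred_def)
  then show ?thesis
    unfolding definable_pred_def by (intro exI[of _ "Not \<phi>"]) auto
qed

lemma definable_pred_conj:
  assumes "definable_pred V P" "definable_pred V Q"
  shows "definable_pred V (\<lambda>E. P E \<and> Q E)"
proof -
  obtain \<phi> \<psi> where "free_vars \<phi> \<subseteq> V" "\<forall>E. sat E \<phi> \<longleftrightarrow> P E" "free_vars \<psi> \<subseteq> V" "\<forall>E. sat E \<psi> \<longleftrightarrow> Q E"
    using assms by (auto simp: definable_pred_def)
  then show ?thesis
    unfolding definable_pred_def by (intro exI[of _ "And \<phi> \<psi>"]) auto
qed

lemma definable_pred_ex:
  assumes "definable_pred V P"
  shows "definable_pred (V - {n}) (\<lambda>E. \<exists>a. P (E(n := a)))"
proof -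
  obtain \<phi> where "free_vars \<phi> \<subseteq> V" "\<forall>E. sat E \<phi> \<longleftrightarrow> P E"
    using assms by (auto simp: definable_pred_def)
  then show ?thesis
    unfolding definable_pred_def by (intro exI[of _ "Ex n \<phi>"]) auto
qed

text \<open>Serves to quantify over all coefficients of a polynomial at once. The function
  \<open>c\<close> is total, but only its values on the block matter, so it amounts to
  \<open>n\<close> single quantifiers; the induction peels off the last variable.\<close>

lemma definable_pred_ex_block:
  assumes "definable_pred V P"
  shows "definable_pred (V - {m..<m + n})
    (\<lambda>E :: nat \<Rightarrow> 'a::linordered_field. \<exists>c. P (\<lambda>j. if m \<le> j \<and> j < m + n then c j else E j))"
proof (induction n)
  case 0
  have "(\<lambda>j. if m \<le> j \<and> j < m + 0 then c j else E j) = E" for c E :: "nat \<Rightarrow> 'a"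
    by auto
  then show ?case using assms by simp
next
  case (Suc n)
  let ?E = "\<lambda>n c E j. if m \<le> j \<and> j < m + n then c j else E j"
  have "definable_pred (V - {m..<m + n} - {m + n}) (\<lambda>E. \<exists>a c. P (?E n c (E(m + n := a))))"
    using definable_pred_ex[OF Suc] by simp
  moreover have "V - {m..<m + n} - {m + n} = V - {m..<m + Suc n}"
    by auto
  moreover have "(\<exists>a c. P (?E n c (E(m + n := a)))) \<longleftrightarrow> (\<exists>c. P (?E (Suc n) c E))" for E
  proof
    assume "\<exists>a c. P (?E n c (E(m + n := a)))"
    then obtain a c where *: "P (?E n c (E(m + n := a)))" by auto
    have "?E n c (E(m + n := a)) j = ?E (Suc n) (c(m + n := a)) E j" for j
      by (cases "j = m + n") auto
    then have "?E n c (E(m + n := a)) = ?E (Suc n) (c(m + n := a)) E"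
      by (rule ext)
    from iffD1[OF arg_cong[OF this, of P] *] show "\<exists>c. P (?E (Suc n) c E)"
      by (rule exI[of _ "c(m + n := a)"])
  next
    assume "\<exists>c. P (?E (Suc n) c E)"
    then obtain c where *: "P (?E (Suc n) c E)" by auto
    have "?E (Suc n) c E = ?E n c (E(m + n := c (m + n)))"
      by auto
    from iffD1[OF arg_cong[OF this, of P] *] show "\<exists>a c. P (?E n c (E(m + n := a)))"
      by (intro exI)
  qed
  ultimately show ?case by simp
qed

lemma definable_pred_le:
  assumes "definable_term V s" "definable_term V t"
  shows "definable_pred V (\<lambda>E. s E \<le> t E)"
  using definable_pred_not[OF definable_pred_less[OF assms(2,1)]] by (simp add: not_less)

lemma definable_pred_abs_le:
  assumes "definable_term V s" "definable_term V t"
  shows "definable_pred V (\<lambda>E. \<bar>s E\<bar> \<le> t E)"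
proof -
  have "definable_pred V (\<lambda>E. s E \<le> t E \<and> - s E \<le> t E)"
    by (intro definable_pred_conj definable_pred_le definable_term_uminus assms)
  then show ?thesis
    by (simp add: abs_le_iff)
qed

lemma definable_pred_all_le:
  fixes n :: nat
  assumes "\<And>i. i \<le> n \<Longrightarrow> definable_pred V (P i)"
  shows "definable_pred V (\<lambda>E. \<forall>i\<le>n. P i E)"
  using assms
proof (induction n)
  case (Suc n)
  have "definable_pred V (\<lambda>E. (\<forall>i\<le>n. P i E) \<and> P (Suc n) E)"
    by (intro definable_pred_conj Suc) auto
  moreover have "(\<forall>i\<le>Suc n. P i E) \<longleftrightarrow> (\<forall>i\<le>n. P i E) \<and> P (Suc n) E" for E
    by (auto simp: le_Suc_eq)
  ultimately show ?case
    by simp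
qed auto

lemmas definable_intros =
  definable_term_var definable_term_zero definable_term_one definable_term_add definable_term_diff
  definable_term_mult definable_term_power definable_term_sum definable_pred_not definable_pred_conj
  definable_pred_less definable_pred_le definable_pred_abs_le definable_pred_all_le

lemma definable_without_parametersI:
  assumes "definable_pred {0} P" "\<And>E. P E \<longleftrightarrow> E 0 \<in> A"
  shows "definable_without_parameters A"
  using assms by (auto simp: definable_pred_def definable_without_parameters_def)

section \<open>The two defining formulas\<close>

lemma definable_no_power_between:
  "definable_without_parameters
    {x :: 'a::linordered_field. \<exists>\<epsilon> z. 0 < \<epsilon> \<and> 1 \<le> z \<and> \<bar>x\<bar> \<le> z \<and>
       \<not> (\<exists>y. \<epsilon> \<le> z ^ (p + 1) * y ^ p \<and> y ^ p \<le> \<epsilon>)}"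
proof (rule definable_without_parametersI)
  \<comment> \<open>Variable 0 is \<open>x\<close>, 1 is \<epsilon>, 2 is \<open>z\<close> and 3 is
    \<open>y\<close>. The lower bound for \<open>y ^ p\<close> is multiplied by
    \<open>z ^ (p + 1)\<close>, since the language has no division.\<close>
  let ?P = "\<lambda>E :: nat \<Rightarrow> 'a. E 1 \<le> E 2 ^ (p + 1) * E 3 ^ p \<and> E 3 ^ p \<le> E 1"
  let ?Q = "\<lambda>E :: nat \<Rightarrow> 'a. 0 < E 1 \<and> 1 \<le> E 2 \<and> \<bar>E 0\<bar> \<le> E 2 \<and> \<not> (\<exists>y. ?P (E(3 := y)))"
  have "definable_pred {0,1,2,3} ?P"
    by (intro definable_intros) auto
  from definable_pred_ex[OF this, of 3]
  have "definable_pred {0,1,2} (\<lambda>E :: nat \<Rightarrow> 'a. \<exists>y. ?P (E(3 := y)))"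
    by (simp add: insert_Diff_if)
  then have "definable_pred {0,1,2} ?Q"
    by (intro definable_intros) auto
  from definable_pred_ex[OF definable_pred_ex[OF this, of 2], of 1]
  have "definable_pred ({0,1,2} - {2} - {1}) (\<lambda>E. \<exists>\<epsilon> z. ?Q (E(1 := \<epsilon>, 2 := z)))" .
  also have "{0,1,2} - {2} - {1} = {0::nat}" by auto
  finally show "definable_pred {0} (\<lambda>E. \<exists>\<epsilon> z. ?Q (E(1 := \<epsilon>, 2 := z)))" .
qed simp

text \<open>With \<open>F\<close> the polynomial with coefficients \<open>c\<close>, the solutions
  \<open>x\<close> form the union over \<open>y\<close> in \<open>[a, b]\<close> of the intervals
  with end points \<open>-1 / \<bar>F y\<bar>\<close> and \<open>1 / \<bar>F y\<bar>\<close>, or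
  everything if \<open>F\<close> has a root there. Hence with \<open>x\<close> every element of
  smaller absolute value is a solution.\<close>

definition approx_root :: "nat \<Rightarrow> 'a::linordered_field \<Rightarrow> 'a \<Rightarrow> (nat \<Rightarrow> 'a) \<Rightarrow> 'a \<Rightarrow> bool" where
  "approx_root n a b c x \<longleftrightarrow> (\<exists>y. a \<le> y \<and> y \<le> b \<and> \<bar>x * (\<Sum>i\<le>n. c i * y ^ i)\<bar> \<le> 1)"

lemma approx_root_cong:
  assumes "\<And>i. i \<le> n \<Longrightarrow> c i = d i"
  shows "approx_root n a b c = approx_root n a b d"
proof -
  have "(\<Sum>i\<le>n. c i * y ^ i) = (\<Sum>i\<le>n. d i * y ^ i)" for y
    using assms by (intro sum.cong) auto
  then show ?thesis
    unfolding approx_root_def by simp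
qed

text \<open>The coefficients and the end points are required to lie in the set that they define, so that
  the polynomial and the interval survive reduction modulo the valuation ideal.\<close>

definition cut_data :: "nat \<Rightarrow> 'a::linordered_field \<Rightarrow> 'a \<Rightarrow> (nat \<Rightarrow> 'a) \<Rightarrow> bool" where
  "cut_data n a b c \<longleftrightarrow> a \<le> b \<and> (\<Sum>i\<le>n. c i * a ^ i) \<le> 0 \<and> 0 \<le> (\<Sum>i\<le>n. c i * b ^ i) \<and>
     approx_root n a b c a \<and> approx_root n a b c b \<and> (\<forall>i\<le>n. approx_root n a b c (c i))"

lemma cut_data_cong:
  assumes "\<And>i. i \<le> n \<Longrightarrow> c i = d i"
  shows "cut_data n a b c = cut_data n a b d"
proof -
  have "(\<Sum>i\<le>n. c i * y ^ i) = (\<Sum>i\<le>n. d i * y ^ i)" for y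
    using assms by (intro sum.cong) auto
  moreover have "approx_root n a b c = approx_root n a b d"
    using assms by (rule approx_root_cong)
  ultimately show ?thesis
    unfolding cut_data_def using assms by simp
qed

text \<open>Variable 0 is reserved for \<open>x\<close>, 1 and 2 for the end points, 3 for the bound
  point \<open>y\<close>, and the \<open>n + 1\<close> variables from 4 on for the
  coefficients.\<close>

lemma definable_approx_root:
  assumes "k \<in> {0,1,2} \<union> {4..<5 + n}"
  shows "definable_pred ({0,1,2} \<union> {4..<5 + n})
    (\<lambda>E :: nat \<Rightarrow> 'a::linordered_field. approx_root n (E 1) (E 2) (\<lambda>i. E (i + 4)) (E k))"
proof -
  let ?P = "\<lambda>E :: nat \<Rightarrow> 'a. E 1 \<le> E 3 \<and> E 3 \<le> E 2 \<and> \<bar>E k * (\<Sum>i\<le>n. E (i + 4) * E 3 ^ i)\<bar> \<le> 1"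
  have "definable_pred (insert 3 ({0,1,2} \<union> {4..<5 + n})) ?P"
    using assms by (intro definable_intros) auto
  from definable_pred_ex[OF this, of 3]
  have "definable_pred ({0,1,2} \<union> {4..<5 + n}) (\<lambda>E :: nat \<Rightarrow> 'a. \<exists>y. ?P (E(3 := y)))"
    by (rule back_subst[of "\<lambda>V. definable_pred V _"]) auto
  moreover have "k \<noteq> 3" using assms by auto
  ultimately show ?thesis
    by (simp add: approx_root_def)
qed

lemma definable_cuts:
  "definable_without_parameters
    {x :: 'a::linordered_field. \<forall>a b c. cut_data n a b c \<longrightarrow> approx_root n a b c x}"
proof (rule definable_without_parametersI)
  define R where "R = (\<lambda>a b c x :: 'a. cut_data n a b c \<and> \<not> approx_root n a b c x)"
  \<comment> \<open>Only the first \<open>n + 1\<close> values of \<open>c\<close> matter, so the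
    quantifier over functions \<open>c\<close> can be replaced by one over a block of
    variables.\<close>
  have R_cong: "R a b c = R a b d" if "\<And>i. i \<le> n \<Longrightarrow> c i = d i" for a b c d
    using cut_data_cong[OF that] approx_root_cong[OF that] by (simp add: R_def)
  let ?P = "\<lambda>E :: nat \<Rightarrow> 'a. R (E 1) (E 2) (\<lambda>i. E (i + 4)) (E 0)"
  let ?E = "\<lambda>c E j. if 4 \<le> j \<and> j < 4 + (n + 1) then c j else E j"
  have "definable_pred ({0,1,2} \<union> {4..<5 + n}) ?P"
    unfolding R_def cut_data_def by (intro definable_intros definable_approx_root) auto
  from definable_pred_ex_block[OF this, of 4 "n + 1"]
  have "definable_pred ({0,1,2} \<union> {4..<5 + n} - {4..<4 + (n + 1)}) (\<lambda>E. \<exists>c. ?P (?E c E))" .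
  also have "{0,1,2} \<union> {4..<5 + n} - {4..<4 + (n + 1)} = {0,1,2::nat}"
    by auto
  also have "(\<lambda>E. \<exists>c. ?P (?E c E)) = (\<lambda>E. \<exists>c. R (E 1) (E 2) c (E 0))"
  proof (rule ext, rule iffI)
    fix E :: "nat \<Rightarrow> 'a"
    assume "\<exists>c. R (E 1) (E 2) c (E 0)"
    then obtain c where c: "R (E 1) (E 2) c (E 0)" ..
    \<comment> \<open>The block starts at variable 4, so coefficient \<open>i\<close> has to sit at
      index \<open>i + 4\<close>.\<close>
    define d where "d = (\<lambda>j. c (j - 4))"
    have "?P (?E d E) = R (E 1) (E 2) (\<lambda>i. ?E d E (i + 4)) (E 0)"
      by simp
    also have "R (E 1) (E 2) (\<lambda>i. ?E d E (i + 4)) = R (E 1) (E 2) c"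
      by (rule R_cong) (simp add: d_def)
    finally show "\<exists>c. ?P (?E c E)"
      using c by (intro exI[of _ d]) (simp only:)
  next
    fix E :: "nat \<Rightarrow> 'a"
    assume "\<exists>c. ?P (?E c E)"
    then obtain c where "?P (?E c E)" ..
    then have "R (E 1) (E 2) (\<lambda>i. ?E c E (i + 4)) (E 0)"
      by simp
    then show "\<exists>c. R (E 1) (E 2) c (E 0)"
      by blast
  qed
  finally have "definable_pred {0,1,2} (\<lambda>E. \<exists>c. R (E 1) (E 2) c (E 0))" .
  from definable_pred_ex[OF definable_pred_ex[OF this, of 2], of 1]
  have "definable_pred ({0,1,2} - {2} - {1}) (\<lambda>E. \<exists>a b c. R a b c (E 0))" by simp
  also have "{0,1,2} - {2} - {1} = {0::nat}" by auto
  finally show "definable_pred {0} (\<lambda>E :: nat \<Rightarrow> 'a. \<not> (\<exists>a b c. cut_data n a b c \<and> \<not> approx_root n a b c (E 0)))"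
    unfolding R_def by (rule definable_pred_not)
qed blast

section \<open>Convex valuations and regular value groups\<close>

locale convex_valued_field =
  fixes v :: "'a::linordered_field \<Rightarrow> 'g::linordered_ab_group_add extended"
  assumes convex: "convex_valuation v"
begin

text \<open>Values of nonzero elements, taken in the group itself to compute without the infinite
  values. \<open>val 0\<close> is unspecified, whence the many assumptions
  \<open>x \<noteq> 0\<close>.\<close>

definition val :: "'a \<Rightarrow> 'g" where
  "val x = (THE g. v x = Fin g)"

lemma v_eq_val: "x \<noteq> 0 \<Longrightarrow> v x = Fin (val x)"
  using convex unfolding convex_valuation_def valuation_def val_def by (cases "v x") auto

lemma v_zero: "v 0 = Pinf"
  using convex unfolding convex_valuation_def valuation_def by blast

lemma val_mult: "x \<noteq> 0 \<Longrightarrow> y \<noteq> 0 \<Longrightarrow> val (x * y) = val x + val y"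
proof -
  assume "x \<noteq> 0" "y \<noteq> 0"
  moreover have "v (x * y) = v x + v y"
    using convex unfolding convex_valuation_def valuation_def by blast
  ultimately show ?thesis by (simp add: v_eq_val)
qed

lemma val_one [simp]: "val 1 = 0"
  using val_mult[of 1 1] by simp

text \<open>Twice \<open>val (-1)\<close> is \<open>val 1 = 0\<close>, and an ordered group has no
  torsion.\<close>

lemma val_uminus [simp]: "val (- x) = val x"
proof (cases "x = 0")
  case False
  have "val (-1) + val (-1) = val (- 1 * - 1)"
    by (rule val_mult [symmetric]) auto
  then have "val (-1) = 0" by simp
  then show ?thesis
    using val_mult[of "-1" x] False by simp
qed simp

lemma val_abs [simp]: "val \<bar>x\<bar> = val x"
  by (simp add: abs_if)

lemma val_divide: "x \<noteq> 0 \<Longrightarrow> y \<noteq> 0 \<Longrightarrow> val (x / y) = val x - val y"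
  using val_mult[of "x / y" y] by (simp add: algebra_simps)

lemma mem_valuation_ring: "x \<in> valuation_ring v \<longleftrightarrow> x = 0 \<or> 0 \<le> val x"
  using v_eq_val[of x] by (cases "x = 0") (auto simp: valuation_ring_def v_zero zero_extended_def)

lemma mem_valuation_ideal: "x \<in> valuation_ideal v \<longleftrightarrow> x = 0 \<or> 0 < val x"
  using v_eq_val[of x] by (cases "x = 0") (auto simp: valuation_ideal_def v_zero zero_extended_def)

text \<open>Convexity enters here: \<open>x / y\<close> lies between 0 and 1, hence in the valuation
  ring.\<close>

lemma val_antimono:
  assumes "0 < x" "x \<le> y"
  shows "val y \<le> val x"
proof -
  have "0 \<in> valuation_ring v" "1 \<in> valuation_ring v" "0 \<le> x / y" "x / y \<le> 1"
    using assms by (auto simp: mem_valuation_ring)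
  moreover have "\<forall>x\<in>valuation_ring v. \<forall>y\<in>valuation_ring v. \<forall>z. x \<le> z \<and> z \<le> y \<longrightarrow> z \<in> valuation_ring v"
    using convex unfolding convex_valuation_def by (rule conjunct2)
  ultimately have "x / y \<in> valuation_ring v"
    by blast
  then show ?thesis
    using assms by (auto simp: mem_valuation_ring val_divide)
qed

lemma valuation_ring_abs_le:
  "\<lbrakk>y \<in> valuation_ring v; \<bar>x\<bar> \<le> \<bar>y\<bar>\<rbrakk> \<Longrightarrow> x \<in> valuation_ring v"
  using val_antimono[of "\<bar>x\<bar>" "\<bar>y\<bar>"] by (cases "x = 0") (auto simp: mem_valuation_ring)

lemma carrier_value_group: "carrier (value_group v) = val ` {x. x \<noteq> 0}"
proof -
  have "(\<exists>x. v x = Fin g) \<longleftrightarrow> (\<exists>x. x \<noteq> 0 \<and> g = val x)" for g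
    by (metis extended.distinct(1) extended.inject v_eq_val v_zero)
  then show ?thesis
    by (auto simp: value_group_def)
qed

lemma value_group_simps [simp]: "x \<otimes>\<^bsub>value_group v\<^esub> y = x + y" "\<one>\<^bsub>value_group v\<^esub> = 0"
  by (simp_all add: value_group_def)

lemma val_in_value_group: "x \<noteq> 0 \<Longrightarrow> val x \<in> carrier (value_group v)"
  by (auto simp: carrier_value_group)

lemma comm_group_value_group: "comm_group (value_group v)"
proof (rule comm_groupI)
  fix g assume "g \<in> carrier (value_group v)"
  then obtain x where "x \<noteq> 0" "g = val x"
    by (auto simp: carrier_value_group)
  then have "val (1 / x) \<otimes>\<^bsub>value_group v\<^esub> g = \<one>\<^bsub>value_group v\<^esub>"
    by (simp add: val_divide)
  moreover have "val (1 / x) \<in> carrier (value_group v)"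
    using \<open>x \<noteq> 0\<close> by (intro val_in_value_group) simp
  ultimately show "\<exists>y\<in>carrier (value_group v). y \<otimes>\<^bsub>value_group v\<^esub> g = \<one>\<^bsub>value_group v\<^esub>"
    by blast
next
  fix g h assume "g \<in> carrier (value_group v)" "h \<in> carrier (value_group v)"
  then obtain x y where *: "x \<noteq> 0" "g = val x" "y \<noteq> 0" "h = val y"
    by (auto simp: carrier_value_group)
  then have "val (x * y) \<in> carrier (value_group v)"
    by (intro val_in_value_group) simp
  with * show "g \<otimes>\<^bsub>value_group v\<^esub> h \<in> carrier (value_group v)"
    by (simp add: val_mult)
next
  have "val 1 \<in> carrier (value_group v)"
    by (rule val_in_value_group) simp
  then show "\<one>\<^bsub>value_group v\<^esub> \<in> carrier (value_group v)"
    by simp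
qed (simp_all add: ac_simps)

lemma val_power: "x \<noteq> 0 \<Longrightarrow> val (x ^ n) = val x [^]\<^bsub>value_group v\<^esub> n"
proof (induction n)
  case (Suc n)
  then show ?case by (simp add: val_mult add.commute)
qed simp

lemma val_power_mono:
  assumes "m \<le> n" "x \<noteq> 0" "0 \<le> val x"
  shows "val (x ^ m) \<le> val (x ^ n)"
  using assms
proof (induction n rule: dec_induct)
  case (step n)
  then show ?case
    using add_increasing[of "val x" "val (x ^ m)" "val (x ^ n)"] by (simp add: val_mult)
qed simp

lemma valuation_ring_zero: "0 \<in> valuation_ring v"
  and valuation_ring_one: "1 \<in> valuation_ring v"
  by (auto simp: mem_valuation_ring)

lemma valuation_ring_mult: "\<lbrakk>x \<in> valuation_ring v; y \<in> valuation_ring v\<rbrakk> \<Longrightarrow> x * y \<in> valuation_ring v"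
  by (cases "x = 0 \<or> y = 0") (auto simp: mem_valuation_ring val_mult)

lemma valuation_ring_uminus: "x \<in> valuation_ring v \<Longrightarrow> - x \<in> valuation_ring v"
  by (auto simp: mem_valuation_ring)

lemma valuation_ring_add:
  assumes "x \<in> valuation_ring v" "y \<in> valuation_ring v"
  shows "x + y \<in> valuation_ring v"
proof -
  have "min (v x) (v y) \<le> v (x + y)"
    using convex unfolding convex_valuation_def valuation_def by blast
  then show ?thesis
    using assms unfolding valuation_ring_def mem_Collect_eq by (metis min_def order_trans)
qed

lemma valuation_ring_power: "x \<in> valuation_ring v \<Longrightarrow> x ^ n \<in> valuation_ring v"
  by (induction n) (auto intro: valuation_ring_mult valuation_ring_one)

lemma valuation_ideal_iff: "x \<in> valuation_ideal v \<longleftrightarrow> x = 0 \<or> 1 / x \<notin> valuation_ring v"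
  by (cases "x = 0") (auto simp: mem_valuation_ring mem_valuation_ideal val_divide)

lemma valuation_ideal_subset: "x \<in> valuation_ideal v \<Longrightarrow> x \<in> valuation_ring v"
  by (auto simp: mem_valuation_ring mem_valuation_ideal)

lemma valuation_ideal_mult:
  "\<lbrakk>x \<in> valuation_ring v; y \<in> valuation_ideal v\<rbrakk> \<Longrightarrow> x * y \<in> valuation_ideal v"
  by (cases "x = 0 \<or> y = 0") (auto simp: mem_valuation_ring mem_valuation_ideal val_mult add_nonneg_pos)

lemma valuation_ideal_add:
  assumes "x \<in> valuation_ideal v" "y \<in> valuation_ideal v"
  shows "x + y \<in> valuation_ideal v"
proof -
  have "min (v x) (v y) \<le> v (x + y)"
    using convex unfolding convex_valuation_def valuation_def by blast
  then show ?thesis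
    using assms unfolding valuation_ideal_def mem_Collect_eq by (metis min_def less_le_trans)
qed

lemma valuation_ideal_uminus: "x \<in> valuation_ideal v \<Longrightarrow> - x \<in> valuation_ideal v"
  by (auto simp: mem_valuation_ideal)

text \<open>For \<open>0 < val t\<close> this is the convex subgroup of the value group generated by
  \<open>val t\<close>; the multiples of \<open>val t\<close> appear as values of powers of
  \<open>t\<close>.\<close>

definition val_hull :: "'a \<Rightarrow> 'g set" where
  "val_hull t = {val x | x. x \<noteq> 0 \<and> (\<exists>m. - val (t ^ m) \<le> val x \<and> val x \<le> val (t ^ m))}"

lemma val_hullI: "\<lbrakk>x \<noteq> 0; - val (t ^ m) \<le> val x; val x \<le> val (t ^ m)\<rbrakk> \<Longrightarrow> val x \<in> val_hull t"
  by (auto simp: val_hull_def)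

lemma val_hullE:
  assumes "g \<in> val_hull t"
  obtains x m where "x \<noteq> 0" "g = val x" "- val (t ^ m) \<le> val x" "val x \<le> val (t ^ m)"
  using assms by (auto simp: val_hull_def)

lemma convex_subgroup_val_hull:
  assumes "t \<noteq> 0" "0 < val t"
  shows "convex_subgroup (val_hull t) (value_group v)"
  unfolding convex_subgroup_def
proof (intro conjI ballI impI)
  interpret comm_group "value_group v"
    by (rule comm_group_value_group)
  show "subgroup (val_hull t) (value_group v)"
  proof (rule subgroupI)
    show "val_hull t \<subseteq> carrier (value_group v)"
      by (auto simp: val_hull_def carrier_value_group)
    have "val 1 \<in> val_hull t"
      by (rule val_hullI[of _ _ 0]) auto
    then show "val_hull t \<noteq> {}" by blast
  next
    fix g assume "g \<in> val_hull t"
    then obtain x m where *: "x \<noteq> 0" "g = val x" "- val (t ^ m) \<le> val x" "val x \<le> val (t ^ m)"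
      by (rule val_hullE)
    have "inv\<^bsub>value_group v\<^esub> g = val (1 / x)"
      using * by (intro inv_equality val_in_value_group) (auto simp: val_in_value_group, simp add: val_divide)
    moreover have "val (1 / x) \<in> val_hull t"
      using * by (intro val_hullI[of _ _ m]) (auto simp: val_divide minus_le_iff)
    ultimately show "inv\<^bsub>value_group v\<^esub> g \<in> val_hull t" by simp
  next
    fix g h assume "g \<in> val_hull t" "h \<in> val_hull t"
    then obtain x m y n where *: "x \<noteq> 0" "g = val x" "- val (t ^ m) \<le> val x" "val x \<le> val (t ^ m)"
        "y \<noteq> 0" "h = val y" "- val (t ^ n) \<le> val y" "val y \<le> val (t ^ n)"
      by (elim val_hullE)
    have "val x + val y \<le> val (t ^ m) + val (t ^ n)" "- val (t ^ m) + - val (t ^ n) \<le> val x + val y"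
      using * by (intro add_mono; simp)+
    then have "val (x * y) \<in> val_hull t"
      using * assms by (intro val_hullI[of _ _ "m + n"]) (auto simp: power_add val_mult)
    with * show "g \<otimes>\<^bsub>value_group v\<^esub> h \<in> val_hull t"
      by (simp add: val_mult)
  qed
next
  fix x y z
  assume z: "z \<in> carrier (value_group v)" "x \<le> z \<and> z \<le> y"
  assume "x \<in> val_hull t" "y \<in> val_hull t"
  then obtain m n where *: "- val (t ^ m) \<le> x" "y \<le> val (t ^ n)"
    by (elim val_hullE) auto
  obtain w where w: "z = val w" "w \<noteq> 0"
    using z by (auto simp: carrier_value_group)
  have "val (t ^ m) \<le> val (t ^ max m n)" "val (t ^ n) \<le> val (t ^ max m n)"
    using assms by (auto intro: val_power_mono)
  with * z(2) have "- val (t ^ max m n) \<le> z" "z \<le> val (t ^ max m n)"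
    by (meson neg_le_iff_le order_trans)+
  then show "z \<in> val_hull t"
    using w by (auto intro: val_hullI)
qed

text \<open>With \<open>C\<close> the convex hull of \<open>val t\<close>, divisibility modulo \<open>C\<close> moves \<open>e\<close> into \<open>C\<close>, where the
  multiples of \<open>val t\<close> are cofinal: the least multiple of \<open>p * val t\<close> above it is at most
  \<open>p * val t\<close> away.\<close>

lemma p_regular_interval:
  assumes reg: "p_regular p (value_group v)" and p: "p \<ge> 1"
    and e: "e \<noteq> 0" and t: "t \<noteq> 0" "0 < val t"
  obtains y where "y \<noteq> 0" "val e < val (y ^ p)" "val (y ^ p) \<le> val (e * t ^ p)"
proof -
  let ?G = "value_group v" and ?C = "val_hull t"
  interpret comm_group ?G
    by (rule comm_group_value_group)
  have sub: "convex_subgroup ?C ?G"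
    using convex_subgroup_val_hull t .
  then have "?C \<lhd> ?G"
    by (intro subgroup_imp_normal) (simp add: convex_subgroup_def)
  then interpret C: normal ?C ?G .
  have "val t \<in> ?C"
    using t by (intro val_hullI[of _ _ 1]) (auto simp: order_trans[of "- val t" 0])
  with t have "?C \<noteq> {\<one>\<^bsub>?G\<^esub>}"
    by auto
  with reg sub have "p_divisible p (?G Mod ?C)"
    by (auto simp: p_regular_def)
  moreover have "?C #>\<^bsub>?G\<^esub> val e \<in> carrier (?G Mod ?C)"
    using e by (auto simp: carrier_FactGroup carrier_value_group)
  ultimately obtain H where "H \<in> carrier (?G Mod ?C)" "H [^]\<^bsub>?G Mod ?C\<^esub> p = ?C #>\<^bsub>?G\<^esub> val e"
    by (auto simp: p_divisible_def)
  then obtain y0 where y0: "y0 \<noteq> 0" "(?C #>\<^bsub>?G\<^esub> val y0) [^]\<^bsub>?G Mod ?C\<^esub> p = ?C #>\<^bsub>?G\<^esub> val e"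
    by (auto simp: carrier_FactGroup carrier_value_group)
  then have "?C #>\<^bsub>?G\<^esub> val (y0 ^ p) = ?C #>\<^bsub>?G\<^esub> val e"
    using C.FactGroup_pow[of "val y0" p] by (auto simp: val_power carrier_value_group)
  moreover have "val e \<in> ?C #>\<^bsub>?G\<^esub> val e"
    using e by (intro rcos_self C.subgroup_axioms) (auto simp: carrier_value_group)
  ultimately have "val e \<in> ?C #>\<^bsub>?G\<^esub> val (y0 ^ p)"
    by simp
  then obtain m x where m: "- val (t ^ m) \<le> val x" "val x \<le> val (t ^ m)" and x: "val e = val x + val (y0 ^ p)"
    by (auto simp: r_coset_def elim!: val_hullE)
  \<comment> \<open>The values of \<open>Y n ^ p\<close> form an arithmetic progression with step
    \<open>p * val t\<close>. It starts at or below \<open>val e\<close>, because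
    \<open>Y 0 ^ p\<close> lies \<open>m * p\<close> multiples of \<open>val t\<close> below
    \<open>y0 ^ p\<close>, while \<open>val e\<close> is at most \<open>m\<close> multiples away
    from it.\<close>
  define Y where "Y n = y0 / t ^ m * t ^ n" for n :: nat
  have Y: "Y n \<noteq> 0" for n
    using y0 t by (simp add: Y_def)
  have Y_Suc: "val (Y (Suc n) ^ p) = val (Y n ^ p) + val (t ^ p)" for n
  proof -
    have "Y (Suc n) = Y n * t"
      by (simp add: Y_def)
    then have "Y (Suc n) ^ p = Y n ^ p * t ^ p"
      by (simp only: power_mult_distrib)
    then show ?thesis
      using Y t by (simp add: val_mult)
  qed
  have "val (t ^ 1) \<le> val (t ^ p)"
    using t p by (intro val_power_mono) auto
  with t have pos: "0 < val (t ^ p)"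
    by simp
  have "val (t ^ m) \<le> val (t ^ (m * p))"
    using t p by (intro val_power_mono) auto
  moreover have "Y 0 ^ p * t ^ (m * p) = y0 ^ p"
    using t by (simp add: Y_def power_divide power_mult)
  then have "val (Y 0 ^ p) + val (t ^ (m * p)) = val (y0 ^ p)"
    using Y[of 0] t by (metis power_not_zero val_mult)
  ultimately have "val (Y 0 ^ p) + val (t ^ m) \<le> val (y0 ^ p)"
    by (metis add_left_mono)
  also have "\<dots> \<le> val e + val (t ^ m)"
    using add_right_mono[OF m(1), of "val (t ^ m)"] x by simp
  finally have le: "val (Y 0 ^ p) \<le> val e"
    by simp
  have "val (t ^ m) < val (t ^ (m * p)) + val (t ^ p)"
    using add_le_less_mono[OF \<open>val (t ^ m) \<le> val (t ^ (m * p))\<close> pos] by simp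
  \<comment> \<open>At this index the progression has surely passed \<open>val e\<close>: the value
    of \<open>y0 ^ p\<close> is exceeded by \<open>(m + 1) * p\<close> multiples of
    \<open>val t\<close>.\<close>
  moreover have "Y (2 * m + 1) = y0 * (t ^ m * t)"
    using t by (simp add: Y_def mult_2 power_add)
  then have "Y (2 * m + 1) ^ p = y0 ^ p * (t ^ (m * p) * t ^ p)"
    by (simp only: power_mult_distrib power_mult)
  then have "val (Y (2 * m + 1) ^ p) = val (y0 ^ p) + (val (t ^ (m * p)) + val (t ^ p))"
    using y0 t by (simp add: val_mult)
  ultimately have "val (y0 ^ p) + val (t ^ m) < val (Y (2 * m + 1) ^ p)"
    by simp
  moreover have "val e \<le> val (y0 ^ p) + val (t ^ m)"
    using m(2) x by (simp add: add.commute)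
  ultimately have gt: "val e < val (Y (2 * m + 1) ^ p)"
    by (rule le_less_trans[rotated])
  define n where "n = (LEAST n. val e < val (Y n ^ p))"
  have n: "val e < val (Y n ^ p)"
    unfolding n_def using gt by (rule LeastI)
  with le have "n \<noteq> 0"
    by (metis leD)
  then obtain k where k: "n = Suc k"
    using not0_implies_Suc by blast
  then have "\<not> val e < val (Y k ^ p)"
    unfolding n_def using not_less_Least by (metis lessI)
  then have "val (Y n ^ p) \<le> val (e * t ^ p)"
    using k Y_Suc[of k] e t by (simp add: val_mult)
  with n Y show ?thesis
    using that by blast
qed

section \<open>Definability from a regular value group\<close>

lemma val_power_eq_zero: "z \<noteq> 0 \<Longrightarrow> val z = 0 \<Longrightarrow> val (z ^ n) = 0"
  by (induction n) (auto simp: val_mult)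

lemma definable_if_p_regular:
  assumes p: "Factorial_Ring.prime p" and reg: "p_regular p (value_group v)"
    and ndiv: "\<not> p_divisible p (value_group v)"
  shows "definable_without_parameters (valuation_ring v)"
proof -
  have p1: "p \<ge> 1"
    using p by (rule prime_ge_1_nat)
  have iff: "x \<in> valuation_ring v \<longleftrightarrow> (\<exists>\<epsilon> z. 0 < \<epsilon> \<and> 1 \<le> z \<and> \<bar>x\<bar> \<le> z \<and>
      \<not> (\<exists>y. \<epsilon> \<le> z ^ (p + 1) * y ^ p \<and> y ^ p \<le> \<epsilon>))" (is "_ \<longleftrightarrow> (\<exists>\<epsilon> z. ?P \<epsilon> z)") for x
  proof
    assume x: "x \<in> valuation_ring v"
    obtain e where e: "e \<noteq> 0" and no_root: "\<And>y. y \<noteq> 0 \<Longrightarrow> val (y ^ p) \<noteq> val e"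
      using ndiv unfolding p_divisible_def carrier_value_group by (auto simp: val_power)
    \<comment> \<open>This \<open>z\<close> is a unit of the valuation ring, so multiplication by
      its powers does not change values.\<close>
    define z where "z = max 1 \<bar>x\<bar>"
    have z: "1 \<le> z" "\<bar>x\<bar> \<le> z"
      by (auto simp: z_def)
    have "z \<in> valuation_ring v"
      using x by (auto simp: z_def max_def mem_valuation_ring)
    then have "val z = 0"
      using z val_antimono[of 1 z] by (auto simp: mem_valuation_ring)
    then have vz: "val (z ^ (p + 1)) = 0"
      using z by (intro val_power_eq_zero) auto
    \<comment> \<open>Such a \<open>y\<close> is squeezed to \<open>val (y ^ p) = val e\<close>,
      against the choice of \<open>e\<close>.\<close>
    have False if y: "\<bar>e\<bar> \<le> z ^ (p + 1) * y ^ p" "y ^ p \<le> \<bar>e\<bar>" for y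
    proof -
      have z_pos: "0 < z ^ (p + 1)"
        using z by simp
      have pos: "0 < z ^ (p + 1) * y ^ p"
        using e y(1) by (simp add: less_le_trans del: power_Suc)
      then have y_pos: "0 < y ^ p"
        using z_pos by (rule zero_less_mult_pos)
      then have y0: "y \<noteq> 0"
        using p1 by (auto simp: zero_power)
      have "val (z ^ (p + 1) * y ^ p) \<le> val e"
        using val_antimono[of "\<bar>e\<bar>" "z ^ (p + 1) * y ^ p"] e y(1) by simp
      moreover have "val (z ^ (p + 1) * y ^ p) = val (y ^ p)"
        using vz z_pos y0 by (subst val_mult) auto
      moreover have "val e \<le> val (y ^ p)"
        using val_antimono[of "y ^ p" "\<bar>e\<bar>"] y_pos y(2) by simp
      ultimately show False
        using no_root[OF y0] by simp
    qed
    with e z have "?P \<bar>e\<bar> z"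
      by (metis zero_less_abs_iff)
    then show "\<exists>\<epsilon> z. ?P \<epsilon> z"
      by blast
  next
    assume "\<exists>\<epsilon> z. ?P \<epsilon> z"
    then obtain e z where e: "0 < e" and z: "1 \<le> z" "\<bar>x\<bar> \<le> z"
      and no: "\<And>y. e \<le> z ^ (p + 1) * y ^ p \<Longrightarrow> y ^ p \<le> e \<Longrightarrow> False"
      by blast
    show "x \<in> valuation_ring v"
    proof (rule ccontr)
      assume "x \<notin> valuation_ring v"
      then have "z \<notin> valuation_ring v"
        using z valuation_ring_abs_le[of z x] by auto
      then have vz: "val z < 0"
        by (auto simp: mem_valuation_ring not_le)
      define t where "t = 1 / z"
      have t: "t \<noteq> 0" "0 < val t"
        using z vz by (auto simp: t_def val_divide)
      obtain y where y: "y \<noteq> 0" "val e < val (y ^ p)" "val (y ^ p) \<le> val (e * t ^ p)"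
        using p_regular_interval[OF reg p1 _ t] e by (metis less_irrefl)
      \<comment> \<open>For odd \<open>p\<close> the power \<open>y ^ p\<close> may be negative; the
        absolute value repairs the sign and keeps the value.\<close>
      have vy: "val (\<bar>y\<bar> ^ p) = val (y ^ p)"
        by (metis power_abs val_abs)
      have y_pos: "0 < \<bar>y\<bar> ^ p"
        using y by simp
      have "\<bar>y\<bar> ^ p \<le> e"
      proof (rule ccontr)
        assume "\<not> \<bar>y\<bar> ^ p \<le> e"
        then have "val (\<bar>y\<bar> ^ p) \<le> val e"
          using e by (intro val_antimono) auto
        then show False
          using vy y by simp
      qed
      \<comment> \<open>The exponent \<open>p + 1\<close> instead of \<open>p\<close> leaves a
        factor \<open>z\<close> after cancellation with \<open>t ^ p\<close>. Its negative value
        turns a weak comparison of values into a contradiction.\<close>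
      moreover have "e \<le> z ^ (p + 1) * \<bar>y\<bar> ^ p"
      proof (rule ccontr)
        assume "\<not> e \<le> z ^ (p + 1) * \<bar>y\<bar> ^ p"
        then have "val e \<le> val (z ^ (p + 1) * \<bar>y\<bar> ^ p)"
          using e z y_pos by (intro val_antimono mult_pos_pos) auto
        also have "\<dots> = val (z ^ (p + 1)) + val (\<bar>y\<bar> ^ p)"
          using z y by (intro val_mult) auto
        also have "\<dots> \<le> val (z ^ (p + 1)) + (val e + val (t ^ p))"
          using y e t vy by (simp add: val_mult del: power_Suc)
        also have "\<dots> = val (z ^ (p + 1) * t ^ p) + val e"
          using z t by (subst val_mult) (auto simp: ac_simps)
        also have "z ^ (p + 1) * t ^ p = z"
          using z by (simp add: t_def power_divide)
        finally show False
          using vz by simp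
      qed
      ultimately show False
        using no by blast
    qed
  qed
  have "valuation_ring v = {x. \<exists>\<epsilon> z. 0 < \<epsilon> \<and> 1 \<le> z \<and> \<bar>x\<bar> \<le> z \<and>
      \<not> (\<exists>y. \<epsilon> \<le> z ^ (p + 1) * y ^ p \<and> y ^ p \<le> \<epsilon>)}"
    unfolding set_eq_iff mem_Collect_eq by (intro allI iff)
  then show ?thesis
    using definable_no_power_between[of p] by simp
qed

end

section \<open>Power sums and the polynomials with roots \<open>x\<^sub>i + x\<^sub>j + t x\<^sub>i x\<^sub>j\<close>\<close>

definition power_sum :: "'a::comm_ring_1 list \<Rightarrow> nat \<Rightarrow> 'a" where
  "power_sum xs k = (\<Sum>x\<leftarrow>xs. x ^ k)"

text \<open>The reversed polynomial with roots \<open>xs\<close>: its coefficients are, up to sign,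
  the elementary symmetric functions of \<open>xs\<close>. As a power series it has a logarithmic
  derivative.\<close>

definition root_fps :: "'a::comm_ring_1 list \<Rightarrow> 'a fps" where
  "root_fps xs = (\<Prod>x\<leftarrow>xs. 1 - fps_const x * fps_X)"

lemma geometric_fps:
  fixes x :: "'a::comm_ring_1"
  shows "(1 - fps_const x * fps_X) * Abs_fps (\<lambda>k. x ^ Suc k) = fps_const x"
proof (rule fps_ext)
  fix n
  show "fps_nth ((1 - fps_const x * fps_X) * Abs_fps (\<lambda>k. x ^ Suc k)) n = fps_nth (fps_const x) n"
    by (cases n) (simp_all add: algebra_simps fps_X_mult_nth mult.assoc)
qed

text \<open>The logarithmic derivative of a factor \<open>1 - x X\<close> is minus the geometric
  series with coefficients \<open>x ^ Suc k\<close>; over a product these derivatives add up to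
  power sums. Comparing coefficients gives Newton's identities.\<close>

lemma fps_deriv_root_fps:
  "fps_deriv (root_fps xs) = - root_fps xs * Abs_fps (\<lambda>k. power_sum xs (Suc k))"
proof (induction xs)
  case Nil
  then show ?case by (simp add: root_fps_def power_sum_def fps_zero_def[symmetric])
next
  case (Cons x xs)
  let ?l = "1 - fps_const x * fps_X" and ?g = "Abs_fps (\<lambda>k. x ^ Suc k)"
  let ?S = "Abs_fps (\<lambda>k. power_sum xs (Suc k))"
  have "fps_deriv (root_fps (x # xs)) = ?l * (- root_fps xs * ?S) - fps_const x * root_fps xs"
    using Cons by (simp add: root_fps_def flip: fps_const_neg)
  also have "\<dots> = - (?l * root_fps xs) * (?S + ?g)"
    by (subst geometric_fps[symmetric]) (simp add: algebra_simps)
  also have "?S + ?g = Abs_fps (\<lambda>k. power_sum (x # xs) (Suc k))"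
    by (rule fps_ext) (simp add: power_sum_def add.commute)
  finally show ?case
    by (simp add: root_fps_def)
qed

lemma newton_identity:
  "of_nat (Suc k) * fps_nth (root_fps xs) (Suc k) =
     - (\<Sum>j\<le>k. fps_nth (root_fps xs) j * power_sum xs (Suc (k - j)))"
proof -
  have "fps_nth (fps_deriv (root_fps xs)) k = of_nat (Suc k) * fps_nth (root_fps xs) (Suc k)"
    by simp
  moreover have "fps_nth (- root_fps xs * Abs_fps (\<lambda>k. power_sum xs (Suc k))) k =
      - (\<Sum>j\<le>k. fps_nth (root_fps xs) j * power_sum xs (Suc (k - j)))"
    by (simp add: fps_mult_nth atLeast0AtMost sum_negf)
  ultimately show ?thesis
    by (simp add: fps_deriv_root_fps)
qed

lemma root_fps_0: "fps_nth (root_fps xs) 0 = 1"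
  by (induction xs) (auto simp: root_fps_def)

lemma root_fps_eq_reflect_poly:
  "root_fps xs = fps_of_poly (reflect_poly (\<Prod>x\<leftarrow>xs. [:- x, 1:] :: 'a::field poly))"
proof (induction xs)
  case Nil
  then show ?case by (simp add: root_fps_def)
next
  case (Cons x xs)
  have "reflect_poly [:- x, 1:] = [:1, - x:]"
    by (simp add: reflect_poly_def cCons_def)
  moreover have "fps_of_poly [:1, - x:] = 1 - fps_const x * fps_X"
    by (simp add: fps_of_poly_pCons mult.commute flip: fps_const_neg)
  moreover have "root_fps (x # xs) = (1 - fps_const x * fps_X) * root_fps xs"
    by (simp add: root_fps_def)
  ultimately show ?case
    using Cons by (simp only: list.map prod_list.Cons reflect_poly_mult fps_of_poly_mult)
qed

text \<open>Subfields are sets inside a type of fields. The locale is applied both to the real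
  closed field in its algebraic closure and to the image of the residue field in its real
  closure.\<close>

locale char_0_subfield =
  fixes F :: "'a::field_char_0 set"
  assumes zero: "0 \<in> F" and one: "1 \<in> F"
    and add: "x \<in> F \<Longrightarrow> y \<in> F \<Longrightarrow> x + y \<in> F"
    and uminus: "x \<in> F \<Longrightarrow> - x \<in> F"
    and mult: "x \<in> F \<Longrightarrow> y \<in> F \<Longrightarrow> x * y \<in> F"
    and inverse: "x \<in> F \<Longrightarrow> inverse x \<in> F"
begin

lemma sum_mem: "(\<And>i. i \<in> A \<Longrightarrow> f i \<in> F) \<Longrightarrow> sum f A \<in> F"
  by (induction A rule: infinite_finite_induct) (auto intro: zero add)

lemma of_nat_mem: "of_nat n \<in> F"
  by (induction n) (auto intro: zero add one)

lemma divide: "x \<in> F \<Longrightarrow> y \<in> F \<Longrightarrow> x / y \<in> F"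
  by (simp add: divide_inverse mult inverse)

lemma diff: "x \<in> F \<Longrightarrow> y \<in> F \<Longrightarrow> x - y \<in> F"
  using add[of x "- y"] uminus by simp

lemma root_fps_mem_if_power_sum_mem:
  assumes "\<And>k. power_sum xs k \<in> F"
  shows "fps_nth (root_fps xs) k \<in> F"
proof (induction k rule: less_induct)
  case (less k)
  show ?case
  proof (cases k)
    case 0
    then show ?thesis by (simp add: root_fps_0 one)
  next
    case (Suc m)
    have "of_nat (Suc m) * fps_nth (root_fps xs) (Suc m) \<in> F"
      unfolding newton_identity using less Suc assms
      by (intro uminus sum_mem mult) auto
    then have "of_nat (Suc m) * fps_nth (root_fps xs) (Suc m) / of_nat (Suc m) \<in> F"
      by (intro divide of_nat_mem)
    then show ?thesis
      using Suc by (simp del: of_nat_Suc)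
  qed
qed

lemma power_sum_mem_if_root_fps_mem:
  assumes "\<And>k. fps_nth (root_fps xs) k \<in> F"
  shows "power_sum xs k \<in> F"
proof (induction k rule: less_induct)
  case (less k)
  show ?case
  proof (cases k)
    case 0
    have "power_sum xs 0 = of_nat (length xs)"
      by (induction xs) (auto simp: power_sum_def)
    with 0 show ?thesis by (simp add: of_nat_mem)
  next
    case (Suc m)
    have "of_nat (Suc m) * fps_nth (root_fps xs) (Suc m) =
      - (power_sum xs (Suc m) + (\<Sum>j\<in>{1..m}. fps_nth (root_fps xs) j * power_sum xs (Suc (m - j))))"
      unfolding newton_identity atMost_atLeast0 by (subst sum.atLeast_Suc_atMost) (auto simp: root_fps_0)
    then have "power_sum xs (Suc m) = - (of_nat (Suc m) * fps_nth (root_fps xs) (Suc m)) -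
      (\<Sum>j\<in>{1..m}. fps_nth (root_fps xs) j * power_sum xs (Suc (m - j)))"
      by (simp del: of_nat_Suc)
    also have "\<dots> \<in> F"
      using less Suc assms by (intro diff uminus sum_mem mult of_nat_mem) auto
    finally show ?thesis
      using Suc by simp
  qed
qed

text \<open>Newton's identities determine coefficients and power sums from each other recursively;
  solving for a coefficient divides by \<open>Suc m\<close>, which is possible in characteristic 0.
  Rationality of a polynomial given by its roots can thus be tested on power sums.\<close>

lemma power_sum_mem_iff:
  "(\<forall>k. power_sum xs k \<in> F) \<longleftrightarrow> (\<forall>k. Polynomial.coeff (\<Prod>x\<leftarrow>xs. [:- x, 1:]) k \<in> F)"
proof -
  let ?P = "\<Prod>x\<leftarrow>xs. [:- x, 1:]"
  have nth: "fps_nth (root_fps xs) k =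
    (if k > Polynomial.degree ?P then 0 else Polynomial.coeff ?P (Polynomial.degree ?P - k))" for k
    by (simp add: root_fps_eq_reflect_poly coeff_reflect_poly)
  have "(\<forall>k. fps_nth (root_fps xs) k \<in> F) \<longleftrightarrow> (\<forall>k. Polynomial.coeff ?P k \<in> F)"
  proof (intro iffI allI)
    fix k assume *: "\<forall>k. fps_nth (root_fps xs) k \<in> F"
    show "Polynomial.coeff ?P k \<in> F"
    proof (cases "k \<le> Polynomial.degree ?P")
      case True
      then have "Polynomial.coeff ?P k = fps_nth (root_fps xs) (Polynomial.degree ?P - k)"
        by (simp add: nth)
      with * show ?thesis by simp
    qed (simp add: coeff_eq_0 zero)
  qed (simp add: nth zero)
  then show ?thesis
    using root_fps_mem_if_power_sum_mem power_sum_mem_if_root_fps_mem by metis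
qed

end

section \<open>Laplace's transformation of the list of roots\<close>

fun pairs :: "'a list \<Rightarrow> ('a \<times> 'a) list" where
  "pairs [] = []"
| "pairs (x # xs) = map (Pair x) xs @ pairs xs"

lemma length_pairs: "2 * length (pairs xs) = length xs * (length xs - 1)"
  by (induction xs) (auto simp: algebra_simps, case_tac xs, auto)

lemma set_pairs: "(x, y) \<in> set (pairs xs) \<Longrightarrow> x \<in> set xs \<and> y \<in> set xs"
  by (induction xs) auto

lemma sum_list_pairs:
  fixes f :: "'a \<Rightarrow> 'a \<Rightarrow> 'b::comm_ring_1"
  assumes "\<And>x y. f x y = f y x"
  shows "(\<Sum>x\<leftarrow>xs. \<Sum>y\<leftarrow>xs. f x y) = 2 * (\<Sum>(x, y)\<leftarrow>pairs xs. f x y) + (\<Sum>x\<leftarrow>xs. f x x)"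
proof (induction xs)
  case (Cons z xs)
  have "(\<Sum>x\<leftarrow>xs. f x z) = (\<Sum>x\<leftarrow>xs. f z x)"
    using assms by (metis (no_types))
  then show ?case
    using Cons by (simp add: sum_list_addf comp_def algebra_simps)
qed simp

text \<open>Laplace's trick: a polynomial with roots \<open>x\<^sub>i\<close> is replaced by the one with roots
  \<open>x\<^sub>i + x\<^sub>j + t x\<^sub>i x\<^sub>j\<close>, which removes a factor 2 from the degree.\<close>

definition laplace :: "'a::comm_ring_1 \<Rightarrow> 'a list \<Rightarrow> 'a list" where
  "laplace t xs = map (\<lambda>(x, y). x + y + t * x * y) (pairs xs)"

context char_0_subfield
begin

text \<open>A sum over unordered pairs is half of the sum over all ordered pairs minus the diagonal,
  and both of these expand into power sums of \<open>xs\<close>. This takes the place of the theorem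
  on symmetric functions.\<close>

lemma power_sum_laplace_mem:
  assumes t: "t \<in> F" and xs: "\<And>k. power_sum xs k \<in> F"
  shows "power_sum (laplace t xs) k \<in> F"
proof -
  let ?f = "\<lambda>x y. x + y + t * x * y"
  \<comment> \<open>The monomial factor is there for the induction: expanding one factor
    \<open>?f x y\<close> shifts the exponents \<open>a\<close> and \<open>b\<close>.\<close>
  have two: "(\<Sum>x\<leftarrow>xs. \<Sum>y\<leftarrow>xs. x ^ a * y ^ b * ?f x y ^ k) \<in> F" for a b k
  proof (induction k arbitrary: a b)
    case 0
    have "(\<Sum>x\<leftarrow>xs. \<Sum>y\<leftarrow>xs. x ^ a * y ^ b) = power_sum xs a * power_sum xs b"
      by (simp add: power_sum_def sum_list_const_mult sum_list_mult_const)
    with xs show ?case by (simp add: mult)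
  next
    case (Suc k)
    have "(\<Sum>x\<leftarrow>xs. \<Sum>y\<leftarrow>xs. x ^ a * y ^ b * ?f x y ^ Suc k) =
        (\<Sum>x\<leftarrow>xs. \<Sum>y\<leftarrow>xs. x ^ Suc a * y ^ b * ?f x y ^ k) +
        (\<Sum>x\<leftarrow>xs. \<Sum>y\<leftarrow>xs. x ^ a * y ^ Suc b * ?f x y ^ k) +
        t * (\<Sum>x\<leftarrow>xs. \<Sum>y\<leftarrow>xs. x ^ Suc a * y ^ Suc b * ?f x y ^ k)"
      by (simp add: sum_list_addf[symmetric] sum_list_const_mult[symmetric] algebra_simps)
    also have "\<dots> \<in> F"
      by (intro add mult t Suc)
    finally show ?case .
  qed
  have one: "(\<Sum>x\<leftarrow>xs. x ^ a * ?f x x ^ k) \<in> F" for a k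
  proof (induction k arbitrary: a)
    case 0
    with xs show ?case by (simp add: power_sum_def)
  next
    case (Suc k)
    have "(\<Sum>x\<leftarrow>xs. x ^ a * ?f x x ^ Suc k) =
        (\<Sum>x\<leftarrow>xs. x ^ Suc a * ?f x x ^ k) + (\<Sum>x\<leftarrow>xs. x ^ Suc a * ?f x x ^ k) +
        t * (\<Sum>x\<leftarrow>xs. x ^ Suc (Suc a) * ?f x x ^ k)"
      by (simp add: sum_list_addf[symmetric] sum_list_const_mult[symmetric] algebra_simps)
    also have "\<dots> \<in> F"
      by (intro add mult t Suc)
    finally show ?case .
  qed
  have "power_sum (laplace t xs) k = (\<Sum>(x, y)\<leftarrow>pairs xs. ?f x y ^ k)"
    by (simp add: power_sum_def laplace_def comp_def case_prod_unfold)
  then have "2 * power_sum (laplace t xs) k = (\<Sum>x\<leftarrow>xs. \<Sum>y\<leftarrow>xs. ?f x y ^ k) - (\<Sum>x\<leftarrow>xs. ?f x x ^ k)"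
    using sum_list_pairs[of "\<lambda>x y. ?f x y ^ k" xs] by (simp add: algebra_simps)
  also have "\<dots> \<in> F"
    using two[of 0 0 k] one[of 0 k] by (intro diff) simp_all
  finally have "2 * power_sum (laplace t xs) k / of_nat 2 \<in> F"
    by (intro divide of_nat_mem)
  then show ?thesis by simp
qed

end

section \<open>The intermediate value theorem in real closed fields\<close>

lemma poly_map_to_ac: "poly (map_poly to_ac p) (to_ac x) = to_ac (poly p x)"
  by (induction p) (auto simp: map_poly_pCons)

lemma map_to_ac_add: "map_poly to_ac (p + q) = map_poly to_ac p + map_poly to_ac q"
  by (rule poly_eqI) (simp add: coeff_map_poly)

lemma map_to_ac_mult: "map_poly to_ac (p * q) = map_poly to_ac p * map_poly to_ac q"
  by (rule poly_eqI) (simp add: coeff_map_poly coeff_mult to_ac_sum)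

text \<open>The parameter \<open>sqr\<close> chooses square roots of the nonnegative elements; their
  sign is left open.\<close>

locale real_closed_type =
  fixes sqr :: "'r::linordered_field \<Rightarrow> 'r"
  assumes sqr: "0 \<le> x \<Longrightarrow> sqr x * sqr x = x"
    and odd_root: "\<And>p :: 'r poly. odd (Polynomial.degree p) \<Longrightarrow> \<exists>x. poly p x = 0"
begin

section \<open>The extension of a real closed field by a square root of -1\<close>

definition im :: "'r alg_closure" where
  "im = (SOME z. z * z = -1)"

lemma im_mult_im: "im * im = -1"
proof -
  have "Polynomial.degree [:1, 0, 1 :: 'r alg_closure:] > 0"
    by simp
  then obtain z :: "'r alg_closure" where "poly [:1, 0, 1:] z = 0"
    using alg_closed_imp_poly_has_root by blast
  then have "z * z = -1"
    by (simp add: add_eq_0_iff)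
  then show ?thesis
    unfolding im_def by (rule someI)
qed

definition cplx :: "'r \<Rightarrow> 'r \<Rightarrow> 'r alg_closure" where
  "cplx a b = to_ac a + im * to_ac b"

text \<open>Squaring \<open>a = - i b\<close> gives \<open>a * a + b * b = 0\<close>, which in an
  ordered field forces both to vanish.\<close>

lemma cplx_eq_0_iff: "cplx a b = 0 \<longleftrightarrow> a = 0 \<and> b = 0"
proof
  assume "cplx a b = 0"
  then have "to_ac a = - (im * to_ac b)"
    by (simp add: cplx_def eq_neg_iff_add_eq_0)
  then have "to_ac a * to_ac a = (im * im) * (to_ac b * to_ac b)"
    by (simp add: mult_ac)
  then have "to_ac (a * a + b * b) = 0"
    by (simp add: im_mult_im)
  then have "a * a + b * b = 0"
    by (simp only: to_ac_eq_0_iff)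
  then show "a = 0 \<and> b = 0"
    by (metis sum_squares_eq_zero_iff)
qed (simp add: cplx_def)

lemma cplx_add: "cplx a b + cplx c d = cplx (a + c) (b + d)"
  by (simp add: cplx_def algebra_simps)

lemma cplx_diff: "cplx a b - cplx c d = cplx (a - c) (b - d)"
  by (simp add: cplx_def algebra_simps)

lemma cplx_mult: "cplx a b * cplx c d = cplx (a * c - b * d) (a * d + b * c)"
proof -
  have "cplx a b * cplx c d =
    to_ac (a * c) + (im * im) * to_ac (b * d) + im * to_ac (a * d + b * c)"
    by (simp add: cplx_def algebra_simps)
  then show ?thesis
    by (simp add: im_mult_im cplx_def algebra_simps)
qed

lemma to_ac_eq_cplx: "to_ac a = cplx a 0"
  by (simp add: cplx_def)

text \<open>The field \<open>'r(i)\<close> as a subset of the algebraic closure.\<close>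

definition CC :: "'r alg_closure set" where
  "CC = {cplx a b | a b. True}"

lemma CC_I: "cplx a b \<in> CC"
  by (auto simp: CC_def)

lemma CC_E:
  assumes "z \<in> CC"
  obtains a b where "z = cplx a b"
  using assms by (auto simp: CC_def)

lemma CC_add: "x \<in> CC \<Longrightarrow> y \<in> CC \<Longrightarrow> x + y \<in> CC"
  by (elim CC_E) (simp add: cplx_add CC_I)

lemma CC_diff: "x \<in> CC \<Longrightarrow> y \<in> CC \<Longrightarrow> x - y \<in> CC"
  by (elim CC_E) (simp add: cplx_diff CC_I)

lemma CC_mult: "x \<in> CC \<Longrightarrow> y \<in> CC \<Longrightarrow> x * y \<in> CC"
  by (elim CC_E) (simp add: cplx_mult CC_I)

lemma to_ac_in_CC: "to_ac a \<in> CC"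
  unfolding to_ac_eq_cplx by (rule CC_I)

lemma CC_divide: "x \<in> CC \<Longrightarrow> x / to_ac a \<in> CC"
  using CC_mult[OF _ to_ac_in_CC[of "inverse a"], of x] by (simp only: to_ac_inverse divide_inverse)

text \<open>The classical formula: with \<open>r\<close> the modulus of \<open>a + i b\<close>, the
  parts of a root have squares \<open>(r + a) / 2\<close> and \<open>(r - a) / 2\<close>, both
  nonnegative.\<close>

lemma sqrt_in_CC:
  assumes "z \<in> CC"
  obtains w where "w \<in> CC" "w * w = z"
proof -
  obtain a b where z: "z = cplx a b"
    using assms by (rule CC_E)
  define r where "r = \<bar>sqr (a * a + b * b)\<bar>"
  have r: "r * r = a * a + b * b" "0 \<le> r"
    by (simp_all add: r_def sqr)
  have "\<bar>a\<bar> * \<bar>a\<bar> \<le> r * r"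
    unfolding r(1) by simp
  then have "\<bar>a\<bar> \<le> r"
    using mult_strict_mono'[of r "\<bar>a\<bar>" r "\<bar>a\<bar>"] r(2) by linarith
  define c where "c = sqr ((r + a) / 2)"
  define d where "d = sqr ((r - a) / 2)"
  have "0 \<le> r + a" "0 \<le> r - a"
    using \<open>\<bar>a\<bar> \<le> r\<close> by linarith+
  then have c: "c * c = (r + a) / 2" and d: "d * d = (r - a) / 2"
    unfolding c_def d_def by (simp_all add: sqr)
  have "(2 * c * d) * (2 * c * d) = 4 * ((c * c) * (d * d))"
    by (simp add: mult_ac)
  also have "\<dots> = b * b"
    using r(1) unfolding c d by (simp add: field_simps)
  finally have "2 * c * d = b \<or> 2 * c * d = - b"
    by (simp only: square_eq_iff)
  \<comment> \<open>The squares fix the parts only up to sign; the sign of the imaginary part is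
    adjusted to that of \<open>b\<close>.\<close>
  then have "\<exists>e. e * e = d * d \<and> 2 * c * e = b"
    by (elim disjE) (rule exI[of _ d], simp, rule exI[of _ "- d"], simp)
  then obtain e where e: "e * e = d * d" "2 * c * e = b"
    by blast
  have "c * c - e * e = a"
    by (simp add: c d e field_simps)
  with e have "cplx c e * cplx c e = z"
    by (simp add: z cplx_mult algebra_simps)
  then show ?thesis
    by (rule that[OF CC_I])
qed

text \<open>The quadratic formula: the discriminant \<open>(x + y)\<^sup>2 - 4 x y\<close> is the
  square of \<open>x - y\<close>, and \<open>CC\<close> is closed under square roots.\<close>

lemma CC_if_sum_and_product_in_CC:
  assumes "x + y \<in> CC" "x * y \<in> CC"
  shows "x \<in> CC"
proof -
  have "(x + y) * (x + y) - to_ac 4 * (x * y) \<in> CC"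
    using CC_diff[OF CC_mult[OF assms(1,1)] CC_mult[OF to_ac_in_CC assms(2)]] .
  then obtain w where w: "w \<in> CC" "w * w = (x + y) * (x + y) - to_ac 4 * (x * y)"
    by (rule sqrt_in_CC)
  then have "w * w = (x - y) * (x - y)"
    by (simp add: algebra_simps)
  then have "w = x - y \<or> w = - (x - y)"
    by (simp only: square_eq_iff)
  then have "x - y = w \<or> x - y = to_ac 0 - w"
    by (elim disjE) simp_all
  then have "x - y \<in> CC"
    using w(1) CC_diff[OF to_ac_in_CC w(1)] by (elim disjE) (simp_all only:)
  from CC_divide[OF CC_add[OF assms(1) this], of 2] have "((x + y) + (x - y)) / to_ac 2 \<in> CC" .
  then show ?thesis
    by (simp add: field_simps)
qed

lemma char_0_subfield_range_to_ac: "char_0_subfield (range (to_ac :: 'r \<Rightarrow> 'r alg_closure))"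
proof
  show "0 \<in> range (to_ac :: 'r \<Rightarrow> _)" "1 \<in> range (to_ac :: 'r \<Rightarrow> _)"
    by (metis to_ac_0 rangeI) (metis to_ac_1 rangeI)
  fix x y :: "'r alg_closure"
  assume x: "x \<in> range to_ac"
  then obtain a where a: "x = to_ac a" by blast
  show "- x \<in> range to_ac" "inverse x \<in> range to_ac"
    by (metis a to_ac_minus rangeI) (metis a to_ac_inverse rangeI)
  assume "y \<in> range to_ac"
  then obtain b where b: "y = to_ac b" by blast
  show "x + y \<in> range to_ac" "x * y \<in> range to_ac"
    by (metis a b to_ac_add rangeI) (metis a b to_ac_mult rangeI)
qed

lemma poly_prod_roots: "poly (\<Prod>x\<leftarrow>xs. [:- x, 1:]) z = 0 \<longleftrightarrow> z \<in> set xs" for z :: "'b::idom"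
  by (induction xs) auto

lemma degree_prod_roots: "Polynomial.degree (\<Prod>x\<leftarrow>xs. [:- x, 1 :: 'b::idom:]) = length xs"
proof (induction xs)
  case (Cons x xs)
  have "(\<Prod>x\<leftarrow>xs. [:- x, 1 :: 'b:]) \<noteq> 0"
    by (auto simp: prod_list_zero_iff)
  with Cons show ?case
    by (simp add: degree_mult_eq del: mult_pCons_left)
qed simp

text \<open>Laplace's induction on the power of 2 in the degree.  If infinitely many \<open>t\<close> are tried, two of
  them, \<open>t\<close> and \<open>t'\<close>, give an element of \<open>CC\<close> for the same pair of roots, so that sum and
  product of these roots are in \<open>CC\<close>.\<close>

lemma exists_root_in_CC:
  fixes xs :: "'r alg_closure list"
  assumes "\<And>k. power_sum xs k \<in> range to_ac" "length xs = 2 ^ n * m" "odd m"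
  shows "\<exists>x\<in>set xs. x \<in> CC"
  using assms
proof (induction n arbitrary: xs m)
  case 0
  interpret char_0_subfield "range (to_ac :: 'r \<Rightarrow> 'r alg_closure)"
    by (rule char_0_subfield_range_to_ac)
  let ?P = "\<Prod>x\<leftarrow>xs. [:- x, 1:]"
  have real: "Polynomial.coeff ?P k \<in> range to_ac" for k
    using power_sum_mem_iff[of xs] 0 by blast
  define p where "p = map_poly of_ac ?P"
  have p: "map_poly to_ac p = ?P"
    by (rule poly_eqI) (simp add: p_def coeff_map_poly to_ac_of_ac[OF real])
  have "Polynomial.degree p = length xs"
    using degree_map_poly[of to_ac p] p degree_prod_roots[of xs] by simp
  then obtain r where "poly p r = 0"
    using odd_root[of p] 0 by auto
  then have "poly ?P (to_ac r) = 0"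
    using poly_map_to_ac[of p r] p by simp
  then have "to_ac r \<in> set xs"
    by (simp only: poly_prod_roots)
  then show ?case
    using to_ac_in_CC by blast
next
  case (Suc n)
  interpret char_0_subfield "range (to_ac :: 'r \<Rightarrow> 'r alg_closure)"
    by (rule char_0_subfield_range_to_ac)
  define N where "N = 2 ^ n * m"
  have len: "length xs = 2 * N" "N > 0"
    using Suc.prems by (auto simp: N_def intro: odd_pos)
  have "2 * length (pairs xs) = 2 * (N * (2 * N - 1))"
    unfolding length_pairs len by simp
  \<comment> \<open>From \<open>2 * N\<close> roots one gets \<open>N * (2 * N - 1)\<close> pairs;
    the second factor is odd, so the power of 2 drops by one.\<close>
  then have "length (pairs xs) = 2 ^ n * (m * (2 * N - 1))"
    by (simp add: N_def)
  moreover have "odd (m * (2 * N - 1))"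
    using Suc.prems len by auto
  ultimately have "\<exists>z\<in>set (laplace (to_ac (of_nat k)) xs). z \<in> CC" for k
    using Suc.prems(1) by (intro Suc.IH power_sum_laplace_mem) (auto simp: laplace_def of_nat_mem)
  then have "\<forall>k. \<exists>q\<in>set (pairs xs). fst q + snd q + to_ac (of_nat k) * fst q * snd q \<in> CC"
    by (auto simp: laplace_def case_prod_unfold)
  then obtain q where q: "\<And>k. q k \<in> set (pairs xs)"
      "\<And>k. fst (q k) + snd (q k) + to_ac (of_nat k) * fst (q k) * snd (q k) \<in> CC"
    by metis
  have "finite (range q)"
    using q(1) by (intro finite_subset[OF _ finite_set[of "pairs xs"]]) auto
  then have "\<not> inj q"
    using finite_imageD by fastforce
  then obtain k l where kl: "k \<noteq> l" "q k = q l"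
    by (auto simp: inj_def)
  define x y where "x = fst (q k)" and "y = snd (q k)"
  define t u where "t = (of_nat k :: 'r)" and "u = (of_nat l :: 'r)"
  have tu: "x + y + to_ac t * x * y \<in> CC" "x + y + to_ac u * x * y \<in> CC" "t \<noteq> u"
    using q(2)[of k] q(2)[of l] kl by (auto simp: x_def y_def t_def u_def simp del: to_ac_of_nat)
  have "((x + y + to_ac t * x * y) - (x + y + to_ac u * x * y)) / to_ac (t - u) \<in> CC"
    using CC_divide[OF CC_diff[OF tu(1,2)]] .
  also have "((x + y + to_ac t * x * y) - (x + y + to_ac u * x * y)) = (x * y) * to_ac (t - u)"
    by (simp add: algebra_simps)
  also have "\<dots> / to_ac (t - u) = x * y"
    using tu by (simp del: to_ac_diff)
  finally have xy: "x * y \<in> CC" .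
  have "(x + y + to_ac t * x * y) - to_ac t * (x * y) \<in> CC"
    using CC_diff[OF tu(1) CC_mult[OF to_ac_in_CC xy]] .
  then have "x + y \<in> CC"
    by simp
  then have "x \<in> CC"
    using xy by (rule CC_if_sum_and_product_in_CC)
  moreover have "x \<in> set xs"
    using set_pairs[of x y xs] q(1)[of k] by (simp add: x_def y_def)
  ultimately show ?case
    by blast
qed

text \<open>Over the algebraic closure the polynomial splits, and after division by the leading
  coefficient Newton's identities put the power sums of its roots into \<open>'r\<close>, as
  Laplace's induction requires.\<close>

lemma real_poly_root_in_CC:
  fixes p :: "'r poly"
  assumes "Polynomial.degree p > 0"
  shows "\<exists>z\<in>CC. poly (map_poly to_ac p) z = 0"
proof -
  interpret char_0_subfield "range (to_ac :: 'r \<Rightarrow> 'r alg_closure)"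
    by (rule char_0_subfield_range_to_ac)
  let ?P = "map_poly to_ac p"
  have deg: "Polynomial.degree ?P = Polynomial.degree p"
    by (simp add: degree_map_poly)
  have "?P \<noteq> 0"
    using deg assms by auto
  then obtain A where A: "size A = Polynomial.degree ?P"
      "?P = Polynomial.smult (Polynomial.lead_coeff ?P) (\<Prod>x\<in>#A. [:-x, 1:])"
    using alg_closed_imp_factorization by blast
  obtain xs where xs: "A = mset xs"
    by (metis ex_mset)
  have P: "?P = Polynomial.smult (Polynomial.lead_coeff ?P) (\<Prod>x\<leftarrow>xs. [:-x, 1:])"
    using A(2) unfolding xs by (simp add: prod_mset_prod_list flip: mset_map)
  have lc: "Polynomial.lead_coeff ?P \<noteq> 0"
    using \<open>?P \<noteq> 0\<close> by simp
  have "Polynomial.coeff (\<Prod>x\<leftarrow>xs. [:-x, 1:]) k = Polynomial.coeff ?P k / Polynomial.lead_coeff ?P" for k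
    by (subst P) (use lc in simp)
  also have "\<dots> k \<in> range to_ac" for k
    by (intro divide) (auto simp: coeff_map_poly)
  finally have "Polynomial.coeff (\<Prod>x\<leftarrow>xs. [:-x, 1:]) k \<in> range to_ac" for k .
  then have "power_sum xs k \<in> range to_ac" for k
    using power_sum_mem_iff by blast
  moreover have "length xs > 0"
    using A(1) assms deg xs by simp
  then obtain m where "length xs = 2 ^ multiplicity 2 (length xs) * m" "odd m"
    using multiplicity_decompose'[of "length xs" 2] by auto
  ultimately obtain x where "x \<in> set xs" "x \<in> CC"
    using exists_root_in_CC by blast
  then have "poly ?P x = 0"
    by (subst P) (simp only: poly_smult, simp add: poly_prod_roots)
  with \<open>x \<in> CC\<close> show ?thesis by blast
qed

section \<open>Factorization over a real closed field and the intermediate value theorem\<close>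

lemma poly_eq_factor_mult:
  fixes p :: "'r poly"
  assumes "Polynomial.degree p > 0"
  obtains d q where "p = d * q" "Polynomial.degree q < Polynomial.degree p"
    "(\<exists>u. d = [:- u, 1:]) \<or> (\<forall>x. 0 < poly d x)"
proof -
  obtain z where z: "z \<in> CC" "poly (map_poly to_ac p) z = 0"
    using real_poly_root_in_CC assms by blast
  obtain u w where uw: "z = cplx u w"
    using z(1) by (rule CC_E)
  show ?thesis
  proof (cases "w = 0")
    case True
    then have "poly p u = 0"
      using z uw poly_map_to_ac[of p u] by (simp flip: to_ac_eq_cplx)
    then obtain q where "p = [:- u, 1:] * q"
      by (auto simp: poly_eq_0_iff_dvd)
    moreover from this have "Polynomial.degree q < Polynomial.degree p"
      using assms by (cases "q = 0") (auto simp: degree_mult_eq simp del: mult_pCons_left)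
    ultimately show ?thesis
      using that by blast
  next
    case False
    \<comment> \<open>The product of \<open>X - z\<close> and its conjugate, which is
      \<open>(X - u)\<^sup>2 + w\<^sup>2\<close> and hence positive everywhere.\<close>
    define d where "d = [:u * u + w * w, - (2 * u), 1:]"
    have "poly (map_poly to_ac d) z = cplx (u * u + w * w) 0 + z * (cplx (- (2 * u)) 0 + z)"
      by (simp add: d_def map_poly_pCons to_ac_eq_cplx[symmetric])
    also have "\<dots> = 0"
      by (simp add: uw cplx_add cplx_mult cplx_eq_0_iff algebra_simps)
    finally have "poly (map_poly to_ac d) z = 0" .
    moreover have "p = d * (p div d) + p mod d"
      by simp
    then have "map_poly to_ac p = map_poly to_ac d * map_poly to_ac (p div d) + map_poly to_ac (p mod d)"
      by (metis map_to_ac_add map_to_ac_mult)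
    ultimately have rem: "poly (map_poly to_ac (p mod d)) z = 0"
      using z(2) by simp
    have "d \<noteq> 0" "Polynomial.degree d = 2"
      by (simp_all add: d_def)
    then have "Polynomial.degree (p mod d) < 2"
      using degree_mod_less'[of d p] by (cases "p mod d = 0") auto
    then have "p mod d = [:Polynomial.coeff (p mod d) 0, Polynomial.coeff (p mod d) 1:]"
      by (intro poly_eqI) (auto simp: coeff_pCons coeff_eq_0 split: nat.split)
    then obtain r s where rs: "p mod d = [:r, s:]"
      by blast
    \<comment> \<open>The remainder \<open>r + s X\<close> vanishes at \<open>z\<close>. The
      imaginary part \<open>w * s\<close> gives \<open>s = 0\<close> because
      \<open>w \<noteq> 0\<close>, and then \<open>r = 0\<close>.\<close>
    have "cplx r 0 + z * cplx s 0 = 0"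
      using rem by (simp add: rs map_poly_pCons to_ac_eq_cplx[symmetric])
    then have "p mod d = 0"
      using False by (simp add: uw cplx_add cplx_mult cplx_eq_0_iff rs) auto
    then have "p = d * (p div d)"
      by (metis add.right_neutral mult_div_mod_eq)
    moreover have "Polynomial.degree (p div d) < Polynomial.degree p"
    proof -
      have "p div d \<noteq> 0"
        using \<open>p = d * (p div d)\<close> assms by auto
      then have "Polynomial.degree (d * (p div d)) = 2 + Polynomial.degree (p div d)"
        using \<open>d \<noteq> 0\<close> \<open>Polynomial.degree d = 2\<close> by (simp add: degree_mult_eq)
      then show ?thesis
        using \<open>p = d * (p div d)\<close> by simp
    qed
    moreover have "0 < poly d x" for x
    proof -
      have "poly d x = (x - u) * (x - u) + w * w"
        by (simp add: d_def algebra_simps)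
      moreover have "0 < w * w"
        using False by (simp add: less_le)
      ultimately show ?thesis
        by (simp add: add_nonneg_pos)
    qed
    ultimately show ?thesis
      using that by blast
  qed
qed

text \<open>Induction on the degree. A linear or everywhere positive factor without root between
  \<open>a\<close> and \<open>b\<close> has the same sign at both points, so the cofactor still
  changes sign.\<close>

lemma poly_IVT:
  fixes p :: "'r poly"
  assumes "a < b" "poly p a * poly p b < 0"
  shows "\<exists>x. a < x \<and> x < b \<and> poly p x = 0"
  using assms(2)
proof (induction "Polynomial.degree p" arbitrary: p rule: less_induct)
  case less
  have "Polynomial.degree p > 0"
  proof (rule ccontr)
    assume "\<not> 0 < Polynomial.degree p"
    then obtain c where "p = [:c:]"
      using degree_eq_zeroE by blast
    then show False
      using less.prems by (simp add: mult_less_0_iff)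
  qed
  then obtain d q where dq: "p = d * q" "Polynomial.degree q < Polynomial.degree p"
    and d: "(\<exists>u. d = [:- u, 1:]) \<or> (\<forall>x. 0 < poly d x)"
    by (rule poly_eq_factor_mult)
  show ?case
  proof (cases "\<exists>x. a < x \<and> x < b \<and> poly d x = 0")
    case True
    then show ?thesis
      using dq by auto
  next
    case False
    have nz: "poly d a \<noteq> 0" "poly d b \<noteq> 0"
      using less.prems dq by auto
    have "0 < poly d a * poly d b"
      using d
    proof
      assume "\<exists>u. d = [:- u, 1:]"
      then obtain u where "d = [:- u, 1:]" ..
      with False nz assms(1) show ?thesis
        by (auto simp: zero_less_mult_iff not_less)
    qed simp
    moreover have "(poly d a * poly d b) * (poly q a * poly q b) < 0"
      using less.prems dq by (simp add: mult_ac)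
    ultimately have "poly q a * poly q b < 0"
      by (metis mult_less_0_iff less_asym)
    then show ?thesis
      using less.hyps[OF dq(2)] dq by auto
  qed
qed

end

section \<open>Approximate roots in dense subsets and sign changes in subfields\<close>

lemma poly_bounded:
  fixes p :: "'r::linordered_field poly"
  shows "\<exists>M>0. \<forall>x. \<bar>x\<bar> \<le> B \<longrightarrow> \<bar>poly p x\<bar> \<le> M"
proof (induction p)
  case 0
  show ?case by (rule exI[of _ 1]) simp
next
  case (pCons a p)
  then obtain M where M: "M > 0" "\<And>x. \<bar>x\<bar> \<le> B \<Longrightarrow> \<bar>poly p x\<bar> \<le> M"
    by blast
  have "\<bar>poly (pCons a p) x\<bar> \<le> \<bar>a\<bar> + 1 + \<bar>B\<bar> * M" if "\<bar>x\<bar> \<le> B" for x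
  proof -
    have "\<bar>x * poly p x\<bar> \<le> \<bar>B\<bar> * M"
      unfolding abs_mult using M that by (intro mult_mono) auto
    then show ?thesis
      using abs_triangle_ineq[of a "x * poly p x"] by simp
  qed
  moreover have "0 < \<bar>a\<bar> + 1 + \<bar>B\<bar> * M"
    using M(1) by (simp add: add_nonneg_pos add_pos_nonneg)
  ultimately show ?case by blast
qed

text \<open>Division by \<open>X - r\<close> at a root \<open>r\<close> leaves a cofactor bounded by
  some \<open>M\<close> on the interval, so points of \<open>F\<close> just to the right of
  \<open>r\<close> have small values.\<close>

lemma (in real_closed_type) approx_root_in_dense:
  fixes p :: "'r poly"
  assumes dense: "\<And>u w. u < w \<Longrightarrow> \<exists>x\<in>F. u < x \<and> x < w"
    and ab: "a < b" "poly p a < 0" "0 < poly p b" and \<delta>: "0 < \<delta>"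
  shows "\<exists>x\<in>F. a < x \<and> x < b \<and> \<bar>poly p x\<bar> < \<delta>"
proof -
  obtain r where r: "a < r" "r < b" "poly p r = 0"
    using poly_IVT[of a b p] ab by (auto simp: mult_neg_pos)
  then obtain q where q: "p = [:- r, 1:] * q"
    by (auto simp: poly_eq_0_iff_dvd)
  obtain M where M: "M > 0" "\<And>x. \<bar>x\<bar> \<le> max \<bar>a\<bar> \<bar>b\<bar> \<Longrightarrow> \<bar>poly q x\<bar> \<le> M"
    using poly_bounded by blast
  have "r < min b (r + \<delta> / M)"
    using r M \<delta> by simp
  then obtain x where x: "x \<in> F" "r < x" "x < min b (r + \<delta> / M)"
    using dense by blast
  have "\<bar>x\<bar> \<le> max \<bar>a\<bar> \<bar>b\<bar>"
    using r x by (auto simp: abs_if max_def)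
  then have "\<bar>poly p x\<bar> \<le> (x - r) * M"
    using M x by (simp add: q abs_mult mult_left_mono del: mult_pCons_left)
  also have "\<dots> < \<delta>"
    using x M by (simp add: field_simps)
  finally show ?thesis
    using x r by (intro bexI[of _ x]) auto
qed

text \<open>A Cauchy bound: at absolute value \<open>B\<close> the leading term dominates the sum of
  the others, so it decides the sign. As \<open>B\<close> is built from the coefficients by field
  operations and absolute values, it stays in any subfield containing them. The factor
  \<open>lead_coeff\<close> avoids a distinction by its sign.\<close>

lemma poly_odd_degree_sign_change:
  fixes p :: "'r::linordered_field poly"
  defines "B \<equiv> 1 + (\<Sum>i<Polynomial.degree p. \<bar>Polynomial.coeff p i / Polynomial.lead_coeff p\<bar>)"
  assumes odd: "odd (Polynomial.degree p)"
  shows "poly p (- B) * Polynomial.lead_coeff p < 0" "0 < poly p B * Polynomial.lead_coeff p"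
proof -
  let ?l = "Polynomial.lead_coeff p" and ?n = "Polynomial.degree p"
  have l: "?l \<noteq> 0"
    using odd by auto
  obtain m where m: "?n = Suc m"
    using odd by (cases ?n) auto
  have B1: "1 \<le> B"
    unfolding B_def by (simp add: sum_nonneg)
  have low: "\<bar>\<Sum>i<?n. Polynomial.coeff p i * x ^ i\<bar> < \<bar>?l * x ^ ?n\<bar>" if x: "\<bar>x\<bar> = B" for x
  proof -
    have "\<bar>\<Sum>i<?n. Polynomial.coeff p i * x ^ i\<bar> \<le> (\<Sum>i<?n. \<bar>Polynomial.coeff p i * x ^ i\<bar>)"
      by (rule sum_abs)
    also have "\<dots> \<le> (\<Sum>i<?n. \<bar>?l\<bar> * B ^ m * \<bar>Polynomial.coeff p i / ?l\<bar>)"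
    proof (rule sum_mono)
      fix i assume "i \<in> {..<?n}"
      then have "B ^ i \<le> B ^ m"
        using m B1 by (intro power_increasing) auto
      then have "\<bar>Polynomial.coeff p i\<bar> * B ^ i \<le> \<bar>Polynomial.coeff p i\<bar> * B ^ m"
        by (rule mult_left_mono) simp
      then show "\<bar>Polynomial.coeff p i * x ^ i\<bar> \<le> \<bar>?l\<bar> * B ^ m * \<bar>Polynomial.coeff p i / ?l\<bar>"
        using l x by (simp add: abs_mult power_abs abs_divide mult_ac)
    qed
    also have "\<dots> = \<bar>?l\<bar> * B ^ m * (B - 1)"
      unfolding B_def by (simp add: sum_distrib_left)
    also have "\<dots> < \<bar>?l\<bar> * B ^ m * B"
      using l B1 by (intro mult_strict_left_mono) auto
    also have "\<dots> = \<bar>?l * x ^ ?n\<bar>"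
      using x by (simp add: m abs_mult power_abs)
    finally show ?thesis .
  qed
  have poly: "poly p x = (\<Sum>i<?n. Polynomial.coeff p i * x ^ i) + ?l * x ^ ?n" for x
    by (simp add: poly_altdef lessThan_Suc_atMost[symmetric])
  have gt: "0 < ?l * ?l"
    using l by (simp add: less_le)
  have sgn: "0 < (u + w) * ?l" if "\<bar>u\<bar> < \<bar>w\<bar>" "0 < w * ?l" for u w
    using that by (auto simp: zero_less_mult_iff abs_if split: if_splits)
  have sgn': "(u + w) * ?l < 0" if "\<bar>u\<bar> < \<bar>w\<bar>" "w * ?l < 0" for u w
    using that by (auto simp: mult_less_0_iff abs_if split: if_splits)
  have pos: "0 < ?l * B ^ ?n * ?l"
    using gt B1 mult_pos_pos[OF gt, of "B ^ ?n"] by (simp add: mult_ac)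
  then show "0 < poly p B * ?l"
    unfolding poly using low[of B] B1 by (intro sgn) auto
  have "?l * (- B) ^ ?n * ?l < 0"
    using pos odd by simp
  then show "poly p (- B) * ?l < 0"
    unfolding poly using low[of "- B"] B1 by (intro sgn') auto
qed

text \<open>Used in contraposition: where one of the axioms of real closed fields fails, some
  polynomial over \<open>F\<close> changes its sign between points of \<open>F\<close> without a
  root in \<open>F\<close>.\<close>

lemma char_0_subfield_IVT_imp_real_closed:
  fixes F :: "'r::linordered_field set"
  assumes F: "char_0_subfield F"
    and ivt: "\<And>p a b. \<lbrakk>\<And>i. Polynomial.coeff p i \<in> F; a \<in> F; b \<in> F; a < b; poly p a < 0; 0 < poly p b\<rbrakk>
      \<Longrightarrow> \<exists>x\<in>F. poly p x = 0"
  shows "s \<in> F \<Longrightarrow> 0 \<le> s \<Longrightarrow> \<exists>x\<in>F. x * x = s"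
    and "(\<And>i. Polynomial.coeff p i \<in> F) \<Longrightarrow> odd (Polynomial.degree p) \<Longrightarrow> \<exists>x\<in>F. poly p x = 0"
proof -
  interpret char_0_subfield F by (rule F)
  show "\<exists>x\<in>F. x * x = s" if s: "s \<in> F" "0 \<le> s"
  proof (cases "s = 0")
    case True
    then show ?thesis using zero by (intro bexI[of _ 0]) auto
  next
    case False
    have coeffs: "Polynomial.coeff [:- s, 0, 1:] i \<in> F" for i
      using s by (auto simp: coeff_pCons intro: zero one uminus split: nat.splits)
    \<comment> \<open>Makes \<open>X\<^sup>2 - s\<close> positive at \<open>1 + s\<close>, a point
      of \<open>F\<close>, while it is negative at 0.\<close>
    have "s < (1 + s) * (1 + s)"
      using False s by (simp add: algebra_simps add_pos_nonneg)
    then have "\<exists>x\<in>F. poly [:- s, 0, 1:] x = 0"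
      using False s by (intro ivt[of _ 0 "1 + s"] coeffs zero add one) auto
    then show ?thesis by (auto simp: algebra_simps)
  qed
  assume p: "\<And>i. Polynomial.coeff p i \<in> F" and odd: "odd (Polynomial.degree p)"
  define B where "B = 1 + (\<Sum>i<Polynomial.degree p. \<bar>Polynomial.coeff p i / Polynomial.lead_coeff p\<bar>)"
  have abs: "x \<in> F \<Longrightarrow> \<bar>x\<bar> \<in> F" for x
    by (simp add: abs_if uminus)
  have B: "B \<in> F"
    unfolding B_def by (intro add one sum_mem abs divide p)
  have "1 \<le> B"
    unfolding B_def by (simp add: sum_nonneg)
  then have "- B < B" by simp
  \<comment> \<open>Scaling by the leading coefficient makes the change of sign go from negative to
    positive.\<close>
  define q where "q = Polynomial.smult (Polynomial.lead_coeff p) p"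
  have "\<exists>x\<in>F. poly q x = 0"
    using poly_odd_degree_sign_change[OF odd, folded B_def] B p \<open>- B < B\<close>
    by (intro ivt[of q "- B" B]) (auto simp: q_def mult.commute intro: mult uminus)
  then show "\<exists>x\<in>F. poly p x = 0"
    using odd by (auto simp: q_def)
qed

section \<open>Cuts in the residue field\<close>

text \<open>An abstract residue map into an ordered field, so that the argument about cuts needs no
  cosets. Outside the valuation ring nothing is known about \<rho>.\<close>

locale residue_map = convex_valued_field v
  for v :: "'a::linordered_field \<Rightarrow> 'g::linordered_ab_group_add extended" +
  fixes \<rho> :: "'a \<Rightarrow> 'r::linordered_field"
  assumes rho_one: "\<rho> 1 = 1"
    and rho_add: "\<lbrakk>x \<in> valuation_ring v; y \<in> valuation_ring v\<rbrakk> \<Longrightarrow> \<rho> (x + y) = \<rho> x + \<rho> y"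
    and rho_mult: "\<lbrakk>x \<in> valuation_ring v; y \<in> valuation_ring v\<rbrakk> \<Longrightarrow> \<rho> (x * y) = \<rho> x * \<rho> y"
    and rho_mono: "\<lbrakk>x \<in> valuation_ring v; y \<in> valuation_ring v; x \<le> y\<rbrakk> \<Longrightarrow> \<rho> x \<le> \<rho> y"
    and rho_ideal: "x \<in> valuation_ideal v \<Longrightarrow> \<rho> x = 0"
begin

lemma rho_uminus: "x \<in> valuation_ring v \<Longrightarrow> \<rho> (- x) = - \<rho> x"
  using rho_add[of x "- x"] rho_add[OF valuation_ring_zero valuation_ring_zero]
  by (simp add: valuation_ring_uminus eq_neg_iff_add_eq_0 add.commute)

lemma rho_zero: "\<rho> 0 = 0"
  using rho_add[OF valuation_ring_zero valuation_ring_zero] by simp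

lemma rho_eq_0_iff:
  assumes "x \<in> valuation_ring v"
  shows "\<rho> x = 0 \<longleftrightarrow> x \<in> valuation_ideal v"
proof
  assume *: "\<rho> x = 0"
  show "x \<in> valuation_ideal v"
  proof (rule ccontr)
    assume "x \<notin> valuation_ideal v"
    then have "x \<noteq> 0" "1 / x \<in> valuation_ring v"
      by (auto simp: valuation_ideal_iff)
    then show False
      using rho_mult[OF assms, of "1 / x"] * rho_one by simp
  qed
qed (rule rho_ideal)

lemma rho_power: "x \<in> valuation_ring v \<Longrightarrow> \<rho> (x ^ n) = \<rho> x ^ n"
  by (induction n) (auto simp: rho_one rho_mult valuation_ring_power)

lemma rho_poly:
  fixes n :: nat
  assumes "\<And>i. i \<le> n \<Longrightarrow> c i \<in> valuation_ring v" "x \<in> valuation_ring v"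
  shows "(\<Sum>i\<le>n. c i * x ^ i) \<in> valuation_ring v"
    and "\<rho> (\<Sum>i\<le>n. c i * x ^ i) = (\<Sum>i\<le>n. \<rho> (c i) * \<rho> x ^ i)"
proof -
  have "(\<Sum>i\<le>n. c i * x ^ i) \<in> valuation_ring v \<and>
    \<rho> (\<Sum>i\<le>n. c i * x ^ i) = (\<Sum>i\<le>n. \<rho> (c i) * \<rho> x ^ i)"
    using assms(1)
  proof (induction n)
    case 0
    then show ?case by simp
  next
    case (Suc n)
    have "c (Suc n) * x ^ Suc n \<in> valuation_ring v"
      using Suc.prems assms(2) by (intro valuation_ring_mult valuation_ring_power) auto
    moreover have "\<rho> (c (Suc n) * x ^ Suc n) = \<rho> (c (Suc n)) * \<rho> x ^ Suc n"
      using Suc.prems assms(2) by (simp only: rho_mult valuation_ring_power rho_power)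
    ultimately show ?case
      using Suc by (simp add: valuation_ring_add rho_add)
  qed
  then show "(\<Sum>i\<le>n. c i * x ^ i) \<in> valuation_ring v"
    "\<rho> (\<Sum>i\<le>n. c i * x ^ i) = (\<Sum>i\<le>n. \<rho> (c i) * \<rho> x ^ i)" by auto
qed

lemma less_if_rho_less:
  "\<lbrakk>x \<in> valuation_ring v; y \<in> valuation_ring v; \<rho> x < \<rho> y\<rbrakk> \<Longrightarrow> x < y"
  using rho_mono[of y x] by (meson not_le)

lemma abs_le_1_if_rho: "x \<in> valuation_ring v \<Longrightarrow> \<bar>\<rho> x\<bar> < 1 \<Longrightarrow> \<bar>x\<bar> \<le> 1"
  using less_if_rho_less[of x 1] less_if_rho_less[of "- x" 1]
  by (auto simp: abs_less_iff abs_le_iff rho_one rho_uminus valuation_ring_one valuation_ring_uminus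
      intro: less_imp_le)

lemma valuation_ideal_abs_le_1: "x \<in> valuation_ideal v \<Longrightarrow> \<bar>x\<bar> \<le> 1"
  by (rule abs_le_1_if_rho) (auto simp: rho_ideal valuation_ideal_subset)

text \<open>If \<open>x\<close> or a value of \<open>F\<close> at an end point is in the valuation
  ideal, that product is infinitesimal and an end point serves as \<open>y\<close>. Otherwise the
  reduced polynomial changes its sign strictly, and density gives a residue at which its value is
  below \<open>1 / \<bar>\<rho> x\<bar>\<close>; any lift of it serves as \<open>y\<close>.\<close>

lemma approx_root_in_valuation_ring:
  assumes ivt: "real_closed_type (sqr :: 'r \<Rightarrow> 'r)"
    and dense: "\<And>u w. u < w \<Longrightarrow> \<exists>y\<in>valuation_ring v. u < \<rho> y \<and> \<rho> y < w"
    and c: "\<And>i. i \<le> n \<Longrightarrow> c i \<in> valuation_ring v"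
    and ab: "a \<in> valuation_ring v" "b \<in> valuation_ring v" "a \<le> b"
    and sign: "(\<Sum>i\<le>n. c i * a ^ i) \<le> 0" "0 \<le> (\<Sum>i\<le>n. c i * b ^ i)"
    and x: "x \<in> valuation_ring v"
  shows "approx_root n a b c x"
proof -
  let ?F = "\<lambda>y. \<Sum>i\<le>n. c i * y ^ i"
  define q where "q = (\<Sum>i\<le>n. Polynomial.monom (\<rho> (c i)) i)"
  have F: "?F y \<in> valuation_ring v" "\<rho> (?F y) = poly q (\<rho> y)" if "y \<in> valuation_ring v" for y
    using rho_poly[of n c y] c that by (simp_all add: q_def poly_sum poly_monom)
  have approx: ?thesis if "a \<le> y" "y \<le> b" "x * ?F y \<in> valuation_ideal v" for y
    using that valuation_ideal_abs_le_1 unfolding approx_root_def by blast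
  show ?thesis
  proof (cases "x \<in> valuation_ideal v \<or> ?F a \<in> valuation_ideal v \<or> ?F b \<in> valuation_ideal v")
    case True
    then show ?thesis
    proof (elim disjE)
      assume "x \<in> valuation_ideal v"
      then have "x * ?F a \<in> valuation_ideal v"
        using valuation_ideal_mult F(1)[OF ab(1)] by (metis mult.commute)
      then show ?thesis
        using approx ab by blast
    next
      assume "?F a \<in> valuation_ideal v"
      then show ?thesis
        using approx[of a] valuation_ideal_mult[OF x] ab by blast
    next
      assume "?F b \<in> valuation_ideal v"
      then show ?thesis
        using approx[of b] valuation_ideal_mult[OF x] ab by blast
    qed
  next
    case False
    \<comment> \<open>Only the ideal reduces to 0, so the weak sign conditions become strict ones
      for the residues.\<close>
    then have nz: "\<rho> x \<noteq> 0" "poly q (\<rho> a) \<noteq> 0" "poly q (\<rho> b) \<noteq> 0"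
      using F ab x rho_eq_0_iff by metis+
    have "poly q (\<rho> a) \<le> 0" "0 \<le> poly q (\<rho> b)"
      using rho_mono[OF F(1)[OF ab(1)] valuation_ring_zero sign(1)]
        rho_mono[OF valuation_ring_zero F(1)[OF ab(2)] sign(2)] F(2) ab rho_zero by simp_all
    with nz have sign: "poly q (\<rho> a) < 0" "0 < poly q (\<rho> b)"
      by auto
    then have "\<rho> a < \<rho> b"
      using rho_mono[OF ab] by (metis le_less less_asym)
    then have "\<exists>s\<in>\<rho> ` valuation_ring v. \<rho> a < s \<and> s < \<rho> b \<and> \<bar>poly q s\<bar> < 1 / \<bar>\<rho> x\<bar>"
      using dense sign nz by (intro real_closed_type.approx_root_in_dense[OF ivt]) auto
    then obtain y where y: "y \<in> valuation_ring v" "\<rho> a < \<rho> y" "\<rho> y < \<rho> b"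
        "\<bar>poly q (\<rho> y)\<bar> < 1 / \<bar>\<rho> x\<bar>"
      by blast
    have "\<bar>\<rho> (x * ?F y)\<bar> = \<bar>\<rho> x\<bar> * \<bar>poly q (\<rho> y)\<bar>"
      using F y x by (simp add: rho_mult abs_mult)
    also have "\<dots> < 1"
      using y(4) nz by (simp add: field_simps)
    finally have "\<bar>x * ?F y\<bar> \<le> 1"
      using F y x by (intro abs_le_1_if_rho valuation_ring_mult)
    moreover have "a \<le> y" "y \<le> b"
      using less_if_rho_less y ab by (meson less_imp_le)+
    ultimately show ?thesis
      unfolding approx_root_def by blast
  qed
qed

lemma valuation_ring_eq_cuts:
  assumes ivt: "real_closed_type (sqr :: 'r \<Rightarrow> 'r)"
    and dense: "\<And>u w. u < w \<Longrightarrow> \<exists>y\<in>valuation_ring v. u < \<rho> y \<and> \<rho> y < w"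
    and q: "\<And>i. Polynomial.coeff q i \<in> \<rho> ` valuation_ring v"
    and ab: "a \<in> valuation_ring v" "b \<in> valuation_ring v" "\<rho> a < \<rho> b"
    and sign: "poly q (\<rho> a) < 0" "0 < poly q (\<rho> b)"
    and no_root: "\<And>x. x \<in> valuation_ring v \<Longrightarrow> \<rho> a \<le> \<rho> x \<Longrightarrow> \<rho> x \<le> \<rho> b \<Longrightarrow> poly q (\<rho> x) \<noteq> 0"
  defines "n \<equiv> Polynomial.degree q"
  shows "valuation_ring v = {x. \<forall>a b c. cut_data n a b c \<longrightarrow> approx_root n a b c x}"
proof (intro equalityI subsetI CollectI allI impI)
  fix x a b :: 'a and c :: "nat \<Rightarrow> 'a"
  assume x: "x \<in> valuation_ring v" and cut: "cut_data n a b c"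
  show "approx_root n a b c x"
  proof (rule ccontr)
    assume not: "\<not> approx_root n a b c x"
    \<comment> \<open>A solution \<open>z\<close> outside the valuation ring would exceed
      \<open>x\<close> in absolute value, and its point \<open>y\<close> would make \<open>x\<close>
      a solution. Thus the solutions lie in the ring, and with them the end points and coefficients
      of the cut.\<close>
    have *: "z \<in> valuation_ring v" if z: "approx_root n a b c z" for z
    proof (rule ccontr)
      assume "z \<notin> valuation_ring v"
      then have "\<not> \<bar>z\<bar> \<le> \<bar>x\<bar>"
        using valuation_ring_abs_le[OF x] by blast
      then have "\<bar>x\<bar> \<le> \<bar>z\<bar>"
        by simp
      obtain y where y: "a \<le> y" "y \<le> b" "\<bar>z * (\<Sum>i\<le>n. c i * y ^ i)\<bar> \<le> 1"
        using z unfolding approx_root_def by blast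
      have "\<bar>x * (\<Sum>i\<le>n. c i * y ^ i)\<bar> \<le> \<bar>z * (\<Sum>i\<le>n. c i * y ^ i)\<bar>"
        using \<open>\<bar>x\<bar> \<le> \<bar>z\<bar>\<close> unfolding abs_mult by (rule mult_right_mono) simp
      with y not show False
        unfolding approx_root_def by (meson order_trans)
    qed
    have "approx_root n a b c x"
      using cut x * unfolding cut_data_def
      by (intro approx_root_in_valuation_ring[OF ivt dense]) auto
    with not show False ..
  qed
next
  fix x :: 'a assume "x \<in> {x. \<forall>a b c. cut_data n a b c \<longrightarrow> approx_root n a b c x}"
  then have x: "cut_data n a b c \<Longrightarrow> approx_root n a b c x" for c :: "nat \<Rightarrow> 'a"
    by blast
  have "\<forall>i. \<exists>y. y \<in> valuation_ring v \<and> \<rho> y = Polynomial.coeff q i"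
  proof
    fix i
    obtain y where "Polynomial.coeff q i = \<rho> y" "y \<in> valuation_ring v"
      using q[of i] by (rule imageE)
    then show "\<exists>y. y \<in> valuation_ring v \<and> \<rho> y = Polynomial.coeff q i"
      by (intro exI[of _ y]) simp
  qed
  from choice[OF this] obtain c where c: "\<And>i. c i \<in> valuation_ring v" "\<And>i. \<rho> (c i) = Polynomial.coeff q i"
    by blast
  let ?F = "\<lambda>y. \<Sum>i\<le>n. c i * y ^ i"
  have F: "?F y \<in> valuation_ring v" "\<rho> (?F y) = poly q (\<rho> y)" if "y \<in> valuation_ring v" for y
    using rho_poly[of n c y] c that by (simp_all add: poly_altdef n_def)
  have "a < b"
    using ab by (rule less_if_rho_less)
  have "?F a < 0" "0 < ?F b"
    using less_if_rho_less[OF F(1)[OF ab(1)] valuation_ring_zero]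
      less_if_rho_less[OF valuation_ring_zero F(1)[OF ab(2)]] F(2) ab(1,2) sign
    by (simp_all add: rho_zero)
  with \<open>a < b\<close> have root: "approx_root n a b c z" if "z \<in> valuation_ring v" for z
    using that c ab by (intro approx_root_in_valuation_ring[OF ivt dense]) auto
  \<comment> \<open>The self-referential conditions hold because everything in the valuation ring is
    a solution for the lifted polynomial, in particular its own coefficients and end points.\<close>
  have "cut_data n a b c"
    unfolding cut_data_def using \<open>a < b\<close> \<open>?F a < 0\<close> \<open>0 < ?F b\<close> root c ab by auto
  then obtain y where y: "a \<le> y" "y \<le> b" "\<bar>x * ?F y\<bar> \<le> 1"
    using x unfolding approx_root_def by blast
  have "\<bar>y\<bar> \<le> \<bar>a\<bar> \<or> \<bar>y\<bar> \<le> \<bar>b\<bar>"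
    using y by (auto simp: abs_if)
  then have yO: "y \<in> valuation_ring v"
    using ab valuation_ring_abs_le by blast
  have "\<rho> a \<le> \<rho> y" "\<rho> y \<le> \<rho> b"
    using rho_mono ab y yO by blast+
  then have "poly q (\<rho> y) \<noteq> 0"
    using no_root yO by blast
  then have "?F y \<notin> valuation_ideal v"
    using F[OF yO] rho_ideal by auto
  \<comment> \<open>The reduction has no root between the residues of \<open>a\<close> and
    \<open>b\<close>, so \<open>F y\<close> is a unit, and a solution is bounded by its
    inverse.\<close>
  then have unit: "?F y \<noteq> 0" "1 / ?F y \<in> valuation_ring v"
    by (auto simp: valuation_ideal_iff)
  then have "\<bar>x\<bar> \<le> \<bar>1 / ?F y\<bar>"
    using y(3) by (simp add: abs_mult abs_divide pos_le_divide_eq)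
  then show "x \<in> valuation_ring v"
    using unit valuation_ring_abs_le by blast
qed

end

section \<open>The residue field\<close>

lemma ring_of_type_algebra_simps [simp]:
  "carrier ring_of_type_algebra = UNIV"
  "x \<otimes>\<^bsub>ring_of_type_algebra\<^esub> y = x * y" "\<one>\<^bsub>ring_of_type_algebra\<^esub> = 1"
  "x \<oplus>\<^bsub>ring_of_type_algebra\<^esub> y = x + y" "\<zero>\<^bsub>ring_of_type_algebra\<^esub> = 0"
  by (simp_all add: ring_of_type_algebra_def)

text \<open>Links the two representations of polynomials: \<open>ring.eval\<close> reads lists with
  the leading coefficient first, \<open>Poly\<close> with the constant coefficient first, whence the
  \<open>rev\<close>.\<close>

lemma ring_hom_eval_eq_poly:
  assumes "ring S" and h: "h \<in> ring_hom S (ring_of_type_algebra :: 'r::comm_ring_1 ring)"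
    and "set p \<subseteq> carrier S" and x: "x \<in> carrier S"
  shows "h (ring.eval S p x) = poly (Poly (rev (map h p))) (h x)"
  using assms(3)
proof (induction p)
  case Nil
  have "ring (ring_of_type_algebra :: 'r ring)" by (rule ring_from_type_algebra)
  then show ?case
    using ring_hom_zero[OF h assms(1)] by (simp add: ring.eval.simps[OF assms(1)])
next
  case (Cons a p)
  interpret ring S by (rule assms(1))
  have pow: "h (x [^]\<^bsub>S\<^esub> n) = h x ^ n" for n :: nat
    by (induction n) (use x ring_hom_one[OF h] ring_hom_mult[OF h] in \<open>simp_all add: mult.commute\<close>)
  have "eval p x \<in> carrier S"
    using Cons.prems x by (intro eval_in_carrier) auto
  then have "h (eval (a # p) x) = h a * h x ^ length p + h (eval p x)"
    using Cons.prems x ring_hom_mult[OF h] ring_hom_add[OF h] by (simp add: pow)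
  then show ?case
    using Cons by (simp add: Poly_append poly_monom add.commute mult.commute)
qed

lemma real_closed_type_if_real_closed:
  assumes "real_closed (ring_of_type_algebra :: 'r::linordered_field ring) (\<le>)"
  obtains sqr :: "'r::linordered_field \<Rightarrow> 'r" where "real_closed_type sqr"
proof -
  let ?R = "ring_of_type_algebra :: 'r ring"
  have ring: "ring ?R" by (rule ring_from_type_algebra)
  have "\<forall>x::'r. 0 \<le> x \<longrightarrow> (\<exists>y. y * y = x)"
    using assms by (simp add: real_closed_def)
  then obtain sqr :: "'r \<Rightarrow> 'r" where sqr: "\<And>x. 0 \<le> x \<Longrightarrow> sqr x * sqr x = x"
    by metis
  have "\<exists>x. poly p x = 0" if p: "odd (Polynomial.degree p)" for p :: "'r poly"
  proof -
    define L where "L = rev (coeffs p)"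
    have "p \<noteq> 0" using p by auto
    then have L: "L \<in> carrier (univ_poly ?R (carrier ?R))"
      by (auto simp: L_def univ_poly_def polynomial_def hd_rev last_coeffs_eq_coeff_degree)
    have "Polynomials.degree L = Polynomial.degree p"
      by (simp add: L_def degree_eq_length_coeffs)
    with p have "odd (Polynomials.degree L)"
      by simp
    with L assms have "\<exists>x\<in>carrier ?R. ring.eval ?R L x = \<zero>\<^bsub>?R\<^esub>"
      unfolding real_closed_def by blast
    then obtain x where x: "ring.eval ?R L x = 0"
      by auto
    have "id \<in> ring_hom ?R ?R"
      by (rule ring_hom_memI) auto
    then have "ring.eval ?R L x = poly (Poly (rev L)) x"
      using ring_hom_eval_eq_poly[OF ring, of id L x] by simp
    with x show ?thesis by (auto simp: L_def)
  qed
  with sqr have "real_closed_type sqr"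
    by unfold_locales
  then show ?thesis by (rule that)
qed

section \<open>The residue field as a quotient of the valuation ring\<close>

context convex_valued_field
begin

definition valuation_ring_struct :: "'a ring" where
  "valuation_ring_struct = ring_of_type_algebra\<lparr>carrier := valuation_ring v\<rparr>"

lemma valuation_ring_struct_simps [simp]:
  "carrier valuation_ring_struct = valuation_ring v"
  "x \<otimes>\<^bsub>valuation_ring_struct\<^esub> y = x * y" "\<one>\<^bsub>valuation_ring_struct\<^esub> = 1"
  "x \<oplus>\<^bsub>valuation_ring_struct\<^esub> y = x + y" "\<zero>\<^bsub>valuation_ring_struct\<^esub> = 0"
  by (simp_all add: valuation_ring_struct_def ring_of_type_algebra_def)

lemma cring_valuation_ring: "cring valuation_ring_struct"
proof (intro cringI abelian_groupI comm_monoidI)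
  fix x assume "x \<in> carrier valuation_ring_struct"
  then have "- x \<in> carrier valuation_ring_struct" "- x \<oplus>\<^bsub>valuation_ring_struct\<^esub> x = \<zero>\<^bsub>valuation_ring_struct\<^esub>"
    by (simp_all add: valuation_ring_uminus)
  then show "\<exists>y\<in>carrier valuation_ring_struct. y \<oplus>\<^bsub>valuation_ring_struct\<^esub> x = \<zero>\<^bsub>valuation_ring_struct\<^esub>"
    by blast
qed (simp_all add: valuation_ring_add valuation_ring_mult valuation_ring_zero valuation_ring_one algebra_simps)

lemma ideal_valuation_ideal: "ideal (valuation_ideal v) valuation_ring_struct"
proof (rule idealI)
  interpret cring valuation_ring_struct by (rule cring_valuation_ring)
  show "ring valuation_ring_struct" by (rule ring_axioms)
  show "subgroup (valuation_ideal v) (add_monoid valuation_ring_struct)"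
  proof (rule add.subgroupI)
    show "valuation_ideal v \<subseteq> carrier valuation_ring_struct"
      using valuation_ideal_subset by auto
    show "valuation_ideal v \<noteq> {}"
      using mem_valuation_ideal by blast
    fix x y assume x: "x \<in> valuation_ideal v"
    then have "\<ominus>\<^bsub>valuation_ring_struct\<^esub> x = - x"
      by (intro minus_equality) (auto simp: valuation_ideal_subset valuation_ring_uminus)
    with x show "\<ominus>\<^bsub>valuation_ring_struct\<^esub> x \<in> valuation_ideal v"
      by (simp add: valuation_ideal_uminus)
    assume "y \<in> valuation_ideal v"
    with x show "x \<oplus>\<^bsub>valuation_ring_struct\<^esub> y \<in> valuation_ideal v"
      by (simp add: valuation_ideal_add)
  qed
next
  fix a x assume "a \<in> valuation_ideal v" "x \<in> carrier valuation_ring_struct"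
  then have "x * a \<in> valuation_ideal v"
    by (simp add: valuation_ideal_mult)
  then show "x \<otimes>\<^bsub>valuation_ring_struct\<^esub> a \<in> valuation_ideal v"
    "a \<otimes>\<^bsub>valuation_ring_struct\<^esub> x \<in> valuation_ideal v"
    by (simp_all add: mult.commute)
qed

text \<open>An element outside the valuation ideal is a unit, so an ideal of the ring containing it
  contains 1; thus the valuation ideal is maximal.\<close>

lemma field_residue_field: "field (residue_field v)"
proof -
  interpret ideal "valuation_ideal v" valuation_ring_struct by (rule ideal_valuation_ideal)
  have "maximalideal (valuation_ideal v) valuation_ring_struct"
  proof (rule maximalidealI)
    have "1 \<in> carrier valuation_ring_struct" "1 \<notin> valuation_ideal v"
      by (simp_all add: valuation_ring_one mem_valuation_ideal)
    then show "carrier valuation_ring_struct \<noteq> valuation_ideal v"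
      by blast
  next
    fix J assume J: "ideal J valuation_ring_struct" "valuation_ideal v \<subseteq> J" "J \<subseteq> carrier valuation_ring_struct"
    interpret J: ideal J valuation_ring_struct by (rule J)
    show "J = valuation_ideal v \<or> J = carrier valuation_ring_struct"
    proof (rule disjCI)
      assume "J \<noteq> carrier valuation_ring_struct"
      then have one: "1 \<notin> J"
        using J.one_imp_carrier by auto
      have "x \<in> valuation_ideal v" if "x \<in> J" for x
      proof (rule ccontr)
        assume "x \<notin> valuation_ideal v"
        then have "x \<noteq> 0" "1 / x \<in> valuation_ring v"
          by (auto simp: valuation_ideal_iff)
        then show False
          using J.I_l_closed[OF that, of "1 / x"] one by simp
      qed
      with J(2) show "J = valuation_ideal v" by blast
    qed
  qed (rule ideal_axioms)
  then show ?thesis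
    using maximalideal.quotient_is_field cring_valuation_ring
    unfolding residue_field_def valuation_ring_struct_def by blast
qed

definition residue :: "'a \<Rightarrow> 'a set" where
  "residue x = valuation_ideal v +>\<^bsub>valuation_ring_struct\<^esub> x"

lemma residue_eq: "residue x = {h + x | h. h \<in> valuation_ideal v}"
  by (auto simp: residue_def a_r_coset_def')

lemma residue_field_alt: "residue_field v = valuation_ring_struct Quot valuation_ideal v"
  by (simp add: residue_field_def valuation_ring_struct_def)

lemma carrier_residue_field: "carrier (residue_field v) = residue ` valuation_ring v"
  by (auto simp: residue_field_alt FactRing_def A_RCOSETS_def' residue_def)

lemma residue_ring_hom: "residue \<in> ring_hom valuation_ring_struct (residue_field v)"
proof -
  interpret ideal "valuation_ideal v" valuation_ring_struct by (rule ideal_valuation_ideal)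
  show ?thesis
    using rcos_ring_hom unfolding residue_field_alt residue_def .
qed

lemma mem_residue: "x \<in> residue x"
  using mem_valuation_ideal[of 0] by (force simp: residue_eq)

lemma residue_eq_if_diff_mem:
  assumes "x - y \<in> valuation_ideal v"
  shows "residue x = residue y"
proof -
  have *: "residue x \<subseteq> residue y" if "x - y \<in> valuation_ideal v" for x y
  proof
    fix z assume "z \<in> residue x"
    then obtain h where "h \<in> valuation_ideal v" "z = h + x"
      by (auto simp: residue_eq)
    then have "h + (x - y) \<in> valuation_ideal v" "z = (h + (x - y)) + y"
      using that by (auto intro: valuation_ideal_add)
    then show "z \<in> residue y"
      unfolding residue_eq by blast
  qed
  have "y - x \<in> valuation_ideal v"
    using valuation_ideal_uminus[OF assms] by simp
  with assms * show ?thesis by blast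
qed

end

section \<open>Order embeddings of the residue field\<close>

locale residue_embedding = convex_valued_field v
  for v :: "'a::linordered_field \<Rightarrow> 'g::linordered_ab_group_add extended" +
  fixes \<iota> :: "'a set \<Rightarrow> 'r::linordered_field"
  assumes hom: "\<iota> \<in> ring_hom (residue_field v) ring_of_type_algebra"
    and le_iff: "\<lbrakk>x \<in> carrier (residue_field v); y \<in> carrier (residue_field v)\<rbrakk> \<Longrightarrow>
      residue_le x y \<longleftrightarrow> \<iota> x \<le> \<iota> y"
begin

sublocale k: field "residue_field v"
  by (rule field_residue_field)

lemma iota_zero: "\<iota> \<zero>\<^bsub>residue_field v\<^esub> = 0"
  using ring_hom_zero[OF hom k.ring_axioms] ring_from_type_algebra by simp

lemma iota_add: "\<lbrakk>x \<in> carrier (residue_field v); y \<in> carrier (residue_field v)\<rbrakk> \<Longrightarrow>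
    \<iota> (x \<oplus>\<^bsub>residue_field v\<^esub> y) = \<iota> x + \<iota> y"
  using ring_hom_add[OF hom] by simp

lemma iota_mult: "\<lbrakk>x \<in> carrier (residue_field v); y \<in> carrier (residue_field v)\<rbrakk> \<Longrightarrow>
    \<iota> (x \<otimes>\<^bsub>residue_field v\<^esub> y) = \<iota> x * \<iota> y"
  using ring_hom_mult[OF hom] by simp

sublocale residue_map v "\<lambda>x. \<iota> (residue x)"
proof
  have res: "x \<in> valuation_ring v \<Longrightarrow> residue x \<in> carrier (residue_field v)" for x
    by (simp add: carrier_residue_field)
  show "\<iota> (residue 1) = 1"
    using ring_hom_one[OF residue_ring_hom] ring_hom_one[OF hom] by simp
  have zero: "residue 0 = \<zero>\<^bsub>residue_field v\<^esub>"
    using ring_hom_zero[OF residue_ring_hom _ k.ring_axioms] cring_valuation_ring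
    by (simp add: cring.axioms(1))
  fix x
  show "\<iota> (residue x) = 0" if "x \<in> valuation_ideal v"
    using residue_eq_if_diff_mem[of x 0] that by (simp add: zero iota_zero)
  fix y
  assume x: "x \<in> valuation_ring v" and y: "y \<in> valuation_ring v"
  show "\<iota> (residue (x + y)) = \<iota> (residue x) + \<iota> (residue y)"
    using ring_hom_add[OF residue_ring_hom, of x y] iota_add x y res by simp
  show "\<iota> (residue (x * y)) = \<iota> (residue x) * \<iota> (residue y)"
    using ring_hom_mult[OF residue_ring_hom, of x y] iota_mult x y res by simp
  \<comment> \<open>Each coset contains its representative, so \<open>x\<close> and \<open>y\<close>
    themselves witness \<open>residue_le\<close>.\<close>
  show "\<iota> (residue x) \<le> \<iota> (residue y)" if "x \<le> y"
    using le_iff[OF res res, of x y] x y that mem_residue unfolding residue_le_def by blast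
qed

lemma iota_inj:
  assumes "A \<in> carrier (residue_field v)" "B \<in> carrier (residue_field v)" "\<iota> A = \<iota> B"
  shows "A = B"
proof -
  obtain x y where xy: "x \<in> valuation_ring v" "y \<in> valuation_ring v" "A = residue x" "B = residue y"
    using assms by (auto simp: carrier_residue_field)
  then have mem: "x + - y \<in> valuation_ring v"
    by (intro valuation_ring_add valuation_ring_uminus)
  have "\<iota> (residue (x + - y)) = 0"
    using assms(3) xy by (simp only: rho_add rho_uminus valuation_ring_uminus)
  then have "x - y \<in> valuation_ideal v"
    using rho_eq_0_iff[OF mem] by simp
  then show ?thesis
    using xy residue_eq_if_diff_mem by simp
qed

lemma range_iota: "\<iota> ` carrier (residue_field v) = (\<lambda>x. \<iota> (residue x)) ` valuation_ring v"
  by (simp add: carrier_residue_field image_image)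

lemma char_0_subfield_range_iota: "char_0_subfield (\<iota> ` carrier (residue_field v))"
  unfolding range_iota
proof
  let ?\<rho> = "\<lambda>x. \<iota> (residue x)"
  show "0 \<in> ?\<rho> ` valuation_ring v"
    by (rule image_eqI[where x = 0]) (simp_all add: rho_zero valuation_ring_zero)
  show "1 \<in> ?\<rho> ` valuation_ring v"
    by (rule image_eqI[where x = 1]) (simp_all add: rho_one valuation_ring_one)
  fix s t assume "s \<in> ?\<rho> ` valuation_ring v"
  then obtain x where x: "x \<in> valuation_ring v" "s = ?\<rho> x" by blast
  show "- s \<in> ?\<rho> ` valuation_ring v"
    using x by (intro image_eqI[where x = "- x"]) (simp_all add: rho_uminus valuation_ring_uminus)
  show "inverse s \<in> ?\<rho> ` valuation_ring v"
  proof (cases "s = 0")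
    case True
    then show ?thesis using \<open>0 \<in> ?\<rho> ` valuation_ring v\<close> by simp
  next
    case False
    then have *: "x \<noteq> 0" "1 / x \<in> valuation_ring v"
      using x rho_ideal by (auto simp: valuation_ideal_iff)
    then have "s * ?\<rho> (1 / x) = 1"
      using rho_mult[OF x(1) *(2)] rho_one x by simp
    then have "inverse s = ?\<rho> (1 / x)"
      by (rule inverse_unique)
    then show ?thesis
      using *(2) by (rule image_eqI)
  qed
  assume "t \<in> ?\<rho> ` valuation_ring v"
  then obtain y where y: "y \<in> valuation_ring v" "t = ?\<rho> y" by blast
  show "s + t \<in> ?\<rho> ` valuation_ring v"
    using x y by (intro image_eqI[where x = "x + y"]) (simp_all add: rho_add valuation_ring_add)
  show "s * t \<in> ?\<rho> ` valuation_ring v"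
    using x y by (intro image_eqI[where x = "x * y"]) (simp_all add: rho_mult valuation_ring_mult)
qed

text \<open>The order axioms are pulled back along \<iota>, antisymmetry by its injectivity.\<close>

lemma ordered_field_residue_field: "ordered_field (residue_field v) residue_le"
proof (intro ordered_field.intro ordered_field_axioms.intro)
  show "field (residue_field v)" by (rule field_residue_field)
  show "x = y" if "x \<in> carrier (residue_field v)" "y \<in> carrier (residue_field v)"
    "residue_le x y" "residue_le y x" for x y
    by (rule iota_inj) (use that in \<open>simp_all add: le_iff\<close>)
qed (auto simp: le_iff iota_add iota_mult iota_zero)

lemma real_closed_residue_field:
  assumes ivt: "\<And>p a b. \<lbrakk>\<And>i. Polynomial.coeff p i \<in> \<iota> ` carrier (residue_field v);
      a \<in> \<iota> ` carrier (residue_field v); b \<in> \<iota> ` carrier (residue_field v);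
      a < b; poly p a < 0; 0 < poly p b\<rbrakk> \<Longrightarrow> \<exists>x\<in>\<iota> ` carrier (residue_field v). poly p x = 0"
  shows "real_closed (residue_field v) residue_le"
  unfolding real_closed_def
proof (intro conjI ballI impI)
  let ?k = "residue_field v"
  show "ordered_field ?k residue_le" by (rule ordered_field_residue_field)
  note rc = char_0_subfield_IVT_imp_real_closed[OF char_0_subfield_range_iota ivt]
  show "\<exists>y\<in>carrier ?k. y \<otimes>\<^bsub>?k\<^esub> y = x" if x: "x \<in> carrier ?k" "residue_le \<zero>\<^bsub>?k\<^esub> x" for x
  proof -
    have "\<exists>s\<in>\<iota> ` carrier ?k. s * s = \<iota> x"
      using x le_iff[of "\<zero>\<^bsub>?k\<^esub>" x] by (intro rc(1)) (auto simp: iota_zero)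
    then obtain y where "y \<in> carrier ?k" "\<iota> y * \<iota> y = \<iota> x"
      by blast
    then show ?thesis
      using x by (intro bexI[of _ y] iota_inj) (auto simp: iota_mult)
  qed
  show "\<exists>x\<in>carrier ?k. ring.eval ?k p x = \<zero>\<^bsub>?k\<^esub>"
    if p: "p \<in> carrier (univ_poly ?k (carrier ?k))" "odd (Polynomials.degree p)" for p
  proof -
    \<comment> \<open>The empty list has degree 0, which is even.\<close>
    have ne: "p \<noteq> []"
      using p(2) by auto
    with p(1) have set: "set p \<subseteq> carrier ?k" and lc: "hd p \<noteq> \<zero>\<^bsub>?k\<^esub>"
      by (simp_all add: univ_poly_def polynomial_def)
    have "hd p \<in> carrier ?k"
      using ne set by (cases p) simp_all
    note lc = this lc
    define q where "q = Poly (rev (map \<iota> p))"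
    \<comment> \<open>By injectivity the leading coefficient stays nonzero, so \<open>Poly\<close>
      strips nothing and the degree stays odd.\<close>
    have "\<iota> (hd p) \<noteq> 0"
      using lc iota_inj[of "hd p" "\<zero>\<^bsub>?k\<^esub>"] iota_zero by auto
    then have coeffs: "coeffs q = rev (map \<iota> p)"
      using ne by (cases p) (simp_all add: q_def)
    then have "Polynomial.degree q = Polynomials.degree p"
      by (simp add: degree_eq_length_coeffs)
    moreover have "Polynomial.coeff q i \<in> \<iota> ` carrier ?k" for i
    proof (cases "i < length p")
      case True
      then have "Polynomial.coeff q i = \<iota> (rev p ! i)"
        by (simp add: q_def nth_default_def rev_map)
      moreover have "rev p ! i \<in> carrier ?k"
        using set True nth_mem[of i "rev p"] by auto
      ultimately show ?thesis by blast
    next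
      case False
      then have "Polynomial.coeff q i = \<iota> \<zero>\<^bsub>?k\<^esub>"
        by (simp add: q_def nth_default_def iota_zero)
      then show ?thesis by blast
    qed
    ultimately have "\<exists>s\<in>\<iota> ` carrier ?k. poly q s = 0"
      using p(2) by (intro rc(2)) auto
    then obtain x where x: "x \<in> carrier ?k" "poly q (\<iota> x) = 0"
      by blast
    have "\<iota> (ring.eval ?k p x) = \<iota> \<zero>\<^bsub>?k\<^esub>"
      using ring_hom_eval_eq_poly[OF k.ring_axioms hom set x(1)] x(2) by (simp add: q_def iota_zero)
    then have "ring.eval ?k p x = \<zero>\<^bsub>?k\<^esub>"
      by (rule iota_inj[rotated 2]) (use set x in \<open>auto intro: k.eval_in_carrier\<close>)
    with x show ?thesis by blast
  qed
qed

end

section \<open>Definability from a dense residue field, and the two cases combined\<close>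

lemma dense_image_between:
  fixes F :: "'r::{linordered_field, linorder_topology} set"
  assumes "closure F = UNIV" "u < w"
  shows "\<exists>x\<in>F. u < x \<and> x < w"
proof -
  obtain z where "u < z" "z < w"
    using dense[OF assms(2)] by blast
  then have "{u<..<w} \<inter> closure F \<noteq> {}"
    using assms(1) by auto
  then have "{u<..<w} \<inter> F \<noteq> {}"
    using open_Int_closure_eq_empty[of "{u<..<w}" F] by simp
  then show ?thesis by auto
qed

lemma (in convex_valued_field) definable_if_residue_field_dense:
  fixes \<iota> :: "'a set \<Rightarrow> 'r::{linordered_field, linorder_topology}"
  assumes rc: "real_closure (residue_field v) residue_le \<iota>"
    and dense: "closure (\<iota> ` carrier (residue_field v)) = UNIV"
    and not_rc: "\<not> real_closed (residue_field v) residue_le"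
  shows "definable_without_parameters (valuation_ring v)"
proof -
  interpret residue_embedding v \<iota>
    using rc by unfold_locales (auto simp: real_closure_def)
  let ?F = "\<iota> ` carrier (residue_field v)"
  obtain sqr :: "'r \<Rightarrow> 'r" where sqr: "real_closed_type sqr"
    using real_closed_type_if_real_closed rc unfolding real_closure_def by blast
  have dense': "\<exists>y\<in>valuation_ring v. u < \<iota> (residue y) \<and> \<iota> (residue y) < w" if "u < w" for u w
    using dense_image_between[OF dense that] unfolding range_iota by blast
  \<comment> \<open>Contraposition of \<open>real_closed_residue_field\<close> supplies the
    polynomial with a sign change but without a root.\<close>
  obtain p a b where p: "\<And>i. Polynomial.coeff p i \<in> ?F" "a \<in> ?F" "b \<in> ?F" "a < b"
      "poly p a < 0" "0 < poly p b" "\<And>x. x \<in> ?F \<Longrightarrow> poly p x \<noteq> 0"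
    using not_rc real_closed_residue_field by metis
  obtain a' b' where ab: "a' \<in> valuation_ring v" "b' \<in> valuation_ring v"
      "a = \<iota> (residue a')" "b = \<iota> (residue b')"
    using p(2,3) unfolding range_iota by blast
  have "valuation_ring v =
    {x. \<forall>a b c. cut_data (Polynomial.degree p) a b c \<longrightarrow> approx_root (Polynomial.degree p) a b c x}"
    using p ab by (intro valuation_ring_eq_cuts[OF sqr dense', of p a' b']) (auto simp: range_iota)
  then show ?thesis
    using definable_cuts by simp
qed

theorem corollary3p2:
  fixes v :: "'a::linordered_field \<Rightarrow> 'g::linordered_ab_group_add extended"
  assumes "convex_valuation v"
    and "(\<exists>p::nat. Factorial_Ring.prime p \<and>
            p_regular p (value_group v) \<and> \<not> p_divisible p (value_group v)) \<or>
         ((\<exists>\<iota> :: 'a set \<Rightarrow> 'r::{linordered_field, linorder_topology}.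
             real_closure (residue_field v) residue_le \<iota> \<and>
             closure (\<iota> ` carrier (residue_field v)) = UNIV) \<and>
          \<not> real_closed (residue_field v) residue_le)"
  shows "definable_without_parameters (valuation_ring v)"
proof -
  interpret convex_valued_field v
    using assms(1) by unfold_locales
  show ?thesis
    using assms(2) definable_if_p_regular definable_if_residue_field_dense by blast
qed

end
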